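(* (i) Let $M^3$ be a 3-dimensional almost cosymplectic $(\kappa,\mu,\nu)$-space. If $\kappa<0$ and $\kappa,\mu,\nu$ only vary in the direction of $\xi$, then its curvature tensor can be written as $$R=-\kappa R_1-2\kappa R_3+\mu R_4+\nu R_7 .$$ (ii) Let $M^3$ be a 3-dimensional almost Kenmotsu $(\kappa,\mu,\nu)$-space. If $\kappa<-1$ is a function that only varies in the direction of $\xi$, then its curvature tensor can be written as $$R=-(\kappa+2)R_1-2(\kappa+1)R_3+\mu R_4+\nu R_7 .$$
   Context: Manifolds, tensor fields and functions are smooth. An almost contact metric manifold $(M,\phi,\xi,\eta,g)$ is an odd-dimensional Riemannian manifold $(M,g)$ with a $(1,1)$-tensor field $\phi$, a vector field $\xi$ and a 1-form $\eta$ such that $\eta(\xi)=1$, $\phi^2X=-X+\eta(X)\xi$ and $g(\phi X,\phi Y)=g(X,Y)-\eta(X)\eta(Y)$. Its fundamental 2-form is $\Phi(X,Y)=g(X,\phi Y)$. It is almost cosymplectic if $d\eta=0$ and $d\Phi=0$; it is almost Kenmotsu if $d\eta=0$ and $d\Phi=2\eta\wedge\Phi$. Put $h=\frac12L_\xi\phi$ ($L$ the Lie derivative) and $R(X,Y)Z=\nabla_X\nabla_YZ-\nabla_Y\nabla_XZ-\nabla_{[X,Y]}Z$, with $\nabla$ the Levi-Civita connection. A function $f$ only varies in the direction of $\xi$ if $X(f)=0$ for every vector field $X$ orthogonal to $\xi$. A $(\kappa,\mu,\nu)$-space ($\kappa,\mu,\nu$ smooth functions on $M$) is an almost contact metric manifold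 satisfying, for all $X,Y$, $$R(X,Y)\xi=\kappa\{\eta(Y)X-\eta(X)Y\}+\mu\{\eta(Y)hX-\eta(X)hY\}+\nu\{\eta(Y)\phi hX-\eta(X)\phi hY\}.$$ The tensors are, for all vector fields $X,Y,Z$: $R_1(X,Y)Z=g(Y,Z)X-g(X,Z)Y$; $R_3(X,Y)Z=\eta(X)\eta(Z)Y-\eta(Y)\eta(Z)X+g(X,Z)\eta(Y)\xi-g(Y,Z)\eta(X)\xi$; $R_4(X,Y)Z=g(Y,Z)hX-g(X,Z)hY+g(hY,Z)X-g(hX,Z)Y$; $R_7(X,Y)Z=g(Y,Z)\phi hX-g(X,Z)\phi hY+g(\phi hY,Z)X-g(\phi hX,Z)Y$. *)

theory Defs
  imports "HOL-Analysis.Analysis" "HOL-Library.Function_Algebras"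
begin

section \<open>Functions as a real vector space\<close>

text \<open>
  Together with the pointwise operations of \<^theory>\<open>HOL-Library.Function_Algebras\<close>, this makes
  smooth functions, tangent vectors and vector fields (all of them functions into a real vector
  space) elements of real vector spaces.
\<close>

instantiation "fun" :: (type, real_vector) real_vector
begin

definition scaleR_fun :: "real \<Rightarrow> ('a \<Rightarrow> 'b) \<Rightarrow> 'a \<Rightarrow> 'b" where
  "scaleR_fun c f = (\<lambda>x. c *\<^sub>R f x)"

instance
  by standard (simp_all add: scaleR_fun_def fun_eq_iff scaleR_add_right scaleR_add_left)

end

lemma scaleR_fun_apply [simp]: "(c *\<^sub>R f) x = c *\<^sub>R f x"
  by (simp add: scaleR_fun_def)

definition linear_on :: "'a::real_vector set \<Rightarrow> ('a \<Rightarrow> 'b::real_vector) \<Rightarrow> bool" where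
  "linear_on S f \<longleftrightarrow>
     (\<forall>u\<in>S. \<forall>v\<in>S. f (u + v) = f u + f v) \<and> (\<forall>c. \<forall>u\<in>S. f (c *\<^sub>R u) = c *\<^sub>R f u)"


section \<open>Smooth manifolds\<close>

text \<open>
  On an open subset of a Euclidean space, the usual class of $n$ times continuously
  differentiable maps.
\<close>

primrec Ck_on :: "nat \<Rightarrow> 'a::euclidean_space set \<Rightarrow> ('a \<Rightarrow> 'b::real_normed_vector) \<Rightarrow> bool" where
  "Ck_on 0 S f \<longleftrightarrow> continuous_on S f"
| "Ck_on (Suc n) S f \<longleftrightarrow>
     (\<forall>x\<in>S. f differentiable (at x)) \<and> (\<forall>v. Ck_on n S (\<lambda>x. frechet_derivative f (at x) v))"

definition smooth_on :: "'a::euclidean_space set \<Rightarrow> ('a \<Rightarrow> 'b::real_normed_vector) \<Rightarrow> bool" where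
  "smooth_on S f \<longleftrightarrow> (\<forall>n. Ck_on n S f)"

text \<open>
  A chart is a domain together with a coordinate map; the values of the coordinate map outside
  the domain are irrelevant. The underlying set of the manifold is the whole type.
\<close>

type_synonym ('m, 'e) chart = "'m set \<times> ('m \<Rightarrow> 'e)"

locale smooth_manifold =
  fixes A :: "('m::{t2_space, second_countable_topology}, 'e::euclidean_space) chart set"
  assumes charts: "\<And>U \<psi>. (U, \<psi>) \<in> A \<Longrightarrow>
      open U \<and> open (\<psi> ` U) \<and> homeomorphism U (\<psi> ` U) \<psi> (inv_into U \<psi>)"
    and covering: "\<Union> (fst ` A) = UNIV"
    and compatible: "\<And>U \<psi> V \<theta>. (U, \<psi>) \<in> A \<Longrightarrow> (V, \<theta>) \<in> A \<Longrightarrow>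
      smooth_on (\<psi> ` (U \<inter> V)) (\<theta> \<circ> inv_into U \<psi>)"

definition smooth_fun :: "('m, 'e::euclidean_space) chart set \<Rightarrow> ('m \<Rightarrow> real) \<Rightarrow> bool" where
  "smooth_fun A f \<longleftrightarrow> (\<forall>(U, \<psi>)\<in>A. smooth_on (\<psi> ` U) (f \<circ> inv_into U \<psi>))"


section \<open>Vector fields\<close>

text \<open>
  Tangent vectors at $p$ are the derivations at $p$ of the algebra of smooth functions. They are
  total functionals here, normalised to vanish on functions that are not smooth, so that
  equality of tangent vectors is equality of functionals.
\<close>

type_synonym 'm tvec = "('m \<Rightarrow> real) \<Rightarrow> real"
type_synonym 'm vfield = "'m \<Rightarrow> 'm tvec"

definition tangent_space :: "('m, 'e::euclidean_space) chart set \<Rightarrow> 'm \<Rightarrow> 'm tvec set" where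
  "tangent_space A p = {v.
     linear_on (Collect (smooth_fun A)) v \<and>
     (\<forall>f f'. smooth_fun A f \<and> smooth_fun A f' \<longrightarrow> v (f * f') = f p * v f' + f' p * v f) \<and>
     (\<forall>f. \<not> smooth_fun A f \<longrightarrow> v f = 0)}"

definition dir_deriv :: "'m vfield \<Rightarrow> ('m \<Rightarrow> real) \<Rightarrow> 'm \<Rightarrow> real" where
  "dir_deriv X f = (\<lambda>p. X p f)"

definition vector_field :: "('m, 'e::euclidean_space) chart set \<Rightarrow> 'm vfield \<Rightarrow> bool" where
  "vector_field A X \<longleftrightarrow>
     (\<forall>p. X p \<in> tangent_space A p) \<and> (\<forall>f. smooth_fun A f \<longrightarrow> smooth_fun A (dir_deriv X f))"

definition fscale :: "('m \<Rightarrow> real) \<Rightarrow> 'm vfield \<Rightarrow> 'm vfield" (infixr \<open>\<odot>\<close> 75) where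
  "f \<odot> X = (\<lambda>p. f p *\<^sub>R X p)"

text \<open>
  On a function that is not smooth both terms vanish for vector fields $X$, $Y$, in
  accordance with the normalisation of tangent vectors.
\<close>

definition lie_bracket :: "'m vfield \<Rightarrow> 'm vfield \<Rightarrow> 'm vfield" where
  "lie_bracket X Y = (\<lambda>p f. X p (dir_deriv Y f) - Y p (dir_deriv X f))"


section \<open>Tensor fields\<close>

text \<open>
  Tensor fields are given pointwise, acting on tangent vectors; only their values on the tangent
  spaces matter. The following two operations apply them to vector fields.
\<close>

definition ev1 :: "('m \<Rightarrow> 'm tvec \<Rightarrow> 'b) \<Rightarrow> 'm vfield \<Rightarrow> 'm \<Rightarrow> 'b" where
  "ev1 T X = (\<lambda>p. T p (X p))"

definition ev2 :: "('m \<Rightarrow> 'm tvec \<Rightarrow> 'm tvec \<Rightarrow> 'b) \<Rightarrow> 'm vfield \<Rightarrow> 'm vfield \<Rightarrow> 'm \<Rightarrow> 'b" where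
  "ev2 T X Y = (\<lambda>p. T p (X p) (Y p))"

definition one_form ::
  "('m, 'e::euclidean_space) chart set \<Rightarrow> ('m \<Rightarrow> 'm tvec \<Rightarrow> real) \<Rightarrow> bool" where
  "one_form A \<omega> \<longleftrightarrow>
     (\<forall>p. linear_on (tangent_space A p) (\<omega> p)) \<and>
     (\<forall>X. vector_field A X \<longrightarrow> smooth_fun A (ev1 \<omega> X))"

definition tensor11 ::
  "('m, 'e::euclidean_space) chart set \<Rightarrow> ('m \<Rightarrow> 'm tvec \<Rightarrow> 'm tvec) \<Rightarrow> bool" where
  "tensor11 A T \<longleftrightarrow>
     (\<forall>p. T p ` tangent_space A p \<subseteq> tangent_space A p \<and> linear_on (tangent_space A p) (T p)) \<and>
     (\<forall>X. vector_field A X \<longrightarrow> vector_field A (ev1 T X))"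

definition lie_deriv_tensor11 ::
  "'m vfield \<Rightarrow> ('m \<Rightarrow> 'm tvec \<Rightarrow> 'm tvec) \<Rightarrow> 'm vfield \<Rightarrow> 'm vfield" where
  "lie_deriv_tensor11 V T X = lie_bracket V (ev1 T X) - ev1 T (lie_bracket V X)"

text \<open>
  Exterior derivatives of 1-forms and 2-forms and the wedge product of a 1-form with a 2-form, in
  the convention without factorials. The convention with $1/2$ in $d\eta$ and $1/3$ in both
  $d\Phi$ and $\eta\wedge\Phi$ yields the same almost cosymplectic and almost Kenmotsu conditions.
\<close>

definition ext_deriv1 ::
  "('m \<Rightarrow> 'm tvec \<Rightarrow> real) \<Rightarrow> 'm vfield \<Rightarrow> 'm vfield \<Rightarrow> 'm \<Rightarrow> real" where
  "ext_deriv1 \<omega> X Y =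
     dir_deriv X (ev1 \<omega> Y) - dir_deriv Y (ev1 \<omega> X) - ev1 \<omega> (lie_bracket X Y)"

definition ext_deriv2 ::
  "('m \<Rightarrow> 'm tvec \<Rightarrow> 'm tvec \<Rightarrow> real) \<Rightarrow> 'm vfield \<Rightarrow> 'm vfield \<Rightarrow> 'm vfield \<Rightarrow> 'm \<Rightarrow> real" where
  "ext_deriv2 \<Omega> X Y Z =
     dir_deriv X (ev2 \<Omega> Y Z) - dir_deriv Y (ev2 \<Omega> X Z) + dir_deriv Z (ev2 \<Omega> X Y)
     - ev2 \<Omega> (lie_bracket X Y) Z + ev2 \<Omega> (lie_bracket X Z) Y - ev2 \<Omega> (lie_bracket Y Z) X"

definition wedge12 ::
  "('m \<Rightarrow> 'm tvec \<Rightarrow> real) \<Rightarrow> ('m \<Rightarrow> 'm tvec \<Rightarrow> 'm tvec \<Rightarrow> real) \<Rightarrow>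
     'm vfield \<Rightarrow> 'm vfield \<Rightarrow> 'm vfield \<Rightarrow> 'm \<Rightarrow> real" where
  "wedge12 \<omega> \<Omega> X Y Z =
     ev1 \<omega> X * ev2 \<Omega> Y Z - ev1 \<omega> Y * ev2 \<Omega> X Z + ev1 \<omega> Z * ev2 \<Omega> X Y"


section \<open>Riemannian manifolds, Levi-Civita connection, curvature\<close>

locale riemannian_manifold = smooth_manifold A
  for A :: "('m::{t2_space, second_countable_topology}, 'e::euclidean_space) chart set" +
  fixes g :: "'m \<Rightarrow> 'm tvec \<Rightarrow> 'm tvec \<Rightarrow> real"
  assumes metric_linear:
      "\<And>p u. u \<in> tangent_space A p \<Longrightarrow> linear_on (tangent_space A p) (g p u)"
    and metric_sym:
      "\<And>p u v. u \<in> tangent_space A p \<Longrightarrow> v \<in> tangent_space A p \<Longrightarrow> g p u v = g p v u"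
    and metric_pos:
      "\<And>p u. u \<in> tangent_space A p \<Longrightarrow> u \<noteq> 0 \<Longrightarrow> g p u u > 0"
    and metric_smooth:
      "\<And>X Y. vector_field A X \<Longrightarrow> vector_field A Y \<Longrightarrow> smooth_fun A (ev2 g X Y)"

definition affine_connection ::
  "('m, 'e::euclidean_space) chart set \<Rightarrow> ('m vfield \<Rightarrow> 'm vfield \<Rightarrow> 'm vfield) \<Rightarrow> bool" where
  "affine_connection A nabla \<longleftrightarrow>
     (\<forall>X Y. vector_field A X \<and> vector_field A Y \<longrightarrow> vector_field A (nabla X Y)) \<and>
     (\<forall>X X' Y. vector_field A X \<and> vector_field A X' \<and> vector_field A Y \<longrightarrow>
        nabla (X + X') Y = nabla X Y + nabla X' Y) \<and>
     (\<forall>f X Y. smooth_fun A f \<and> vector_field A X \<and> vector_field A Y \<longrightarrow>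
        nabla (f \<odot> X) Y = f \<odot> nabla X Y) \<and>
     (\<forall>X Y Y'. vector_field A X \<and> vector_field A Y \<and> vector_field A Y' \<longrightarrow>
        nabla X (Y + Y') = nabla X Y + nabla X Y') \<and>
     (\<forall>f X Y. smooth_fun A f \<and> vector_field A X \<and> vector_field A Y \<longrightarrow>
        nabla X (f \<odot> Y) = dir_deriv X f \<odot> Y + f \<odot> nabla X Y)"

definition levi_civita ::
  "('m, 'e::euclidean_space) chart set \<Rightarrow> ('m \<Rightarrow> 'm tvec \<Rightarrow> 'm tvec \<Rightarrow> real) \<Rightarrow>
     ('m vfield \<Rightarrow> 'm vfield \<Rightarrow> 'm vfield) \<Rightarrow> bool" where
  "levi_civita A g nabla \<longleftrightarrow>
     affine_connection A nabla \<and>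
     (\<forall>X Y. vector_field A X \<and> vector_field A Y \<longrightarrow>
        nabla X Y - nabla Y X = lie_bracket X Y) \<and>
     (\<forall>X Y Z. vector_field A X \<and> vector_field A Y \<and> vector_field A Z \<longrightarrow>
        dir_deriv X (ev2 g Y Z) = ev2 g (nabla X Y) Z + ev2 g Y (nabla X Z))"

definition curvature ::
  "('m vfield \<Rightarrow> 'm vfield \<Rightarrow> 'm vfield) \<Rightarrow> 'm vfield \<Rightarrow> 'm vfield \<Rightarrow> 'm vfield \<Rightarrow> 'm vfield" where
  "curvature nabla X Y Z =
     nabla X (nabla Y Z) - nabla Y (nabla X Z) - nabla (lie_bracket X Y) Z"


section \<open>Almost contact metric manifolds\<close>

locale almost_contact_metric_manifold = riemannian_manifold A g
  for A :: "('m::{t2_space, second_countable_topology}, 'e::euclidean_space) chart set"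
    and \<phi> :: "'m \<Rightarrow> 'm tvec \<Rightarrow> 'm tvec"
    and \<xi> :: "'m vfield"
    and \<eta> :: "'m \<Rightarrow> 'm tvec \<Rightarrow> real"
    and g :: "'m \<Rightarrow> 'm tvec \<Rightarrow> 'm tvec \<Rightarrow> real" +
  assumes odd_dimension: "odd DIM('e)"
    and phi_tensor: "tensor11 A \<phi>"
    and xi_field: "vector_field A \<xi>"
    and eta_form: "one_form A \<eta>"
    and eta_xi: "\<And>p. \<eta> p (\<xi> p) = 1"
    and phi_phi: "\<And>p u. u \<in> tangent_space A p \<Longrightarrow> \<phi> p (\<phi> p u) = - u + \<eta> p u *\<^sub>R \<xi> p"
    and metric_phi: "\<And>p u v. u \<in> tangent_space A p \<Longrightarrow> v \<in> tangent_space A p \<Longrightarrow>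
      g p (\<phi> p u) (\<phi> p v) = g p u v - \<eta> p u * \<eta> p v"

definition fundamental_form ::
  "('m \<Rightarrow> 'm tvec \<Rightarrow> 'm tvec) \<Rightarrow> ('m \<Rightarrow> 'm tvec \<Rightarrow> 'm tvec \<Rightarrow> real) \<Rightarrow>
     'm \<Rightarrow> 'm tvec \<Rightarrow> 'm tvec \<Rightarrow> real" where
  "fundamental_form \<phi> g p u v = g p u (\<phi> p v)"

locale almost_cosymplectic_manifold = almost_contact_metric_manifold +
  assumes d_eta: "\<And>X Y. vector_field A X \<Longrightarrow> vector_field A Y \<Longrightarrow> ext_deriv1 \<eta> X Y = 0"
    and d_Phi: "\<And>X Y Z. vector_field A X \<Longrightarrow> vector_field A Y \<Longrightarrow> vector_field A Z \<Longrightarrow>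
      ext_deriv2 (fundamental_form \<phi> g) X Y Z = 0"

locale almost_kenmotsu_manifold = almost_contact_metric_manifold +
  assumes d_eta: "\<And>X Y. vector_field A X \<Longrightarrow> vector_field A Y \<Longrightarrow> ext_deriv1 \<eta> X Y = 0"
    and d_Phi: "\<And>X Y Z. vector_field A X \<Longrightarrow> vector_field A Y \<Longrightarrow> vector_field A Z \<Longrightarrow>
      ext_deriv2 (fundamental_form \<phi> g) X Y Z = 2 * wedge12 \<eta> (fundamental_form \<phi> g) X Y Z"

definition h_op :: "('m \<Rightarrow> 'm tvec \<Rightarrow> 'm tvec) \<Rightarrow> 'm vfield \<Rightarrow> 'm vfield \<Rightarrow> 'm vfield" where
  "h_op \<phi> \<xi> X = (1 / 2) *\<^sub>R lie_deriv_tensor11 \<xi> \<phi> X"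

definition phi_h_op :: "('m \<Rightarrow> 'm tvec \<Rightarrow> 'm tvec) \<Rightarrow> 'm vfield \<Rightarrow> 'm vfield \<Rightarrow> 'm vfield" where
  "phi_h_op \<phi> \<xi> X = ev1 \<phi> (h_op \<phi> \<xi> X)"

locale kappa_mu_nu_space = almost_contact_metric_manifold A \<phi> \<xi> \<eta> g
  for A :: "('m::{t2_space, second_countable_topology}, 'e::euclidean_space) chart set"
    and \<phi> \<xi> \<eta> g +
  fixes nabla :: "'m vfield \<Rightarrow> 'm vfield \<Rightarrow> 'm vfield"
    and \<kappa> \<mu> \<nu> :: "'m \<Rightarrow> real"
  assumes connection: "levi_civita A g nabla"
    and smooth_coefficients: "smooth_fun A \<kappa>" "smooth_fun A \<mu>" "smooth_fun A \<nu>"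
    and curvature_xi: "\<And>X Y. vector_field A X \<Longrightarrow> vector_field A Y \<Longrightarrow>
      curvature nabla X Y \<xi> =
        \<kappa> \<odot> (ev1 \<eta> Y \<odot> X - ev1 \<eta> X \<odot> Y)
        + \<mu> \<odot> (ev1 \<eta> Y \<odot> h_op \<phi> \<xi> X - ev1 \<eta> X \<odot> h_op \<phi> \<xi> Y)
        + \<nu> \<odot> (ev1 \<eta> Y \<odot> phi_h_op \<phi> \<xi> X - ev1 \<eta> X \<odot> phi_h_op \<phi> \<xi> Y)"

definition varies_only_along ::
  "('m, 'e::euclidean_space) chart set \<Rightarrow> ('m \<Rightarrow> 'm tvec \<Rightarrow> 'm tvec \<Rightarrow> real) \<Rightarrow> 'm vfield \<Rightarrow>
     ('m \<Rightarrow> real) \<Rightarrow> bool" where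
  "varies_only_along A g \<xi> f \<longleftrightarrow>
     (\<forall>X. vector_field A X \<and> ev2 g X \<xi> = 0 \<longrightarrow> dir_deriv X f = 0)"


section \<open>The tensors in the curvature formula\<close>

definition R1 :: "('m \<Rightarrow> 'm tvec \<Rightarrow> 'm tvec \<Rightarrow> real) \<Rightarrow>
     'm vfield \<Rightarrow> 'm vfield \<Rightarrow> 'm vfield \<Rightarrow> 'm vfield" where
  "R1 g X Y Z = ev2 g Y Z \<odot> X - ev2 g X Z \<odot> Y"

definition R3 :: "'m vfield \<Rightarrow> ('m \<Rightarrow> 'm tvec \<Rightarrow> real) \<Rightarrow> ('m \<Rightarrow> 'm tvec \<Rightarrow> 'm tvec \<Rightarrow> real) \<Rightarrow>
     'm vfield \<Rightarrow> 'm vfield \<Rightarrow> 'm vfield \<Rightarrow> 'm vfield" where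
  "R3 \<xi> \<eta> g X Y Z =
     (ev1 \<eta> X * ev1 \<eta> Z) \<odot> Y - (ev1 \<eta> Y * ev1 \<eta> Z) \<odot> X
     + (ev2 g X Z * ev1 \<eta> Y) \<odot> \<xi> - (ev2 g Y Z * ev1 \<eta> X) \<odot> \<xi>"

definition R4 :: "('m \<Rightarrow> 'm tvec \<Rightarrow> 'm tvec) \<Rightarrow> 'm vfield \<Rightarrow> ('m \<Rightarrow> 'm tvec \<Rightarrow> 'm tvec \<Rightarrow> real) \<Rightarrow>
     'm vfield \<Rightarrow> 'm vfield \<Rightarrow> 'm vfield \<Rightarrow> 'm vfield" where
  "R4 \<phi> \<xi> g X Y Z =
     ev2 g Y Z \<odot> h_op \<phi> \<xi> X - ev2 g X Z \<odot> h_op \<phi> \<xi> Y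
     + ev2 g (h_op \<phi> \<xi> Y) Z \<odot> X - ev2 g (h_op \<phi> \<xi> X) Z \<odot> Y"

definition R7 :: "('m \<Rightarrow> 'm tvec \<Rightarrow> 'm tvec) \<Rightarrow> 'm vfield \<Rightarrow> ('m \<Rightarrow> 'm tvec \<Rightarrow> 'm tvec \<Rightarrow> real) \<Rightarrow>
     'm vfield \<Rightarrow> 'm vfield \<Rightarrow> 'm vfield \<Rightarrow> 'm vfield" where
  "R7 \<phi> \<xi> g X Y Z =
     ev2 g Y Z \<odot> phi_h_op \<phi> \<xi> X - ev2 g X Z \<odot> phi_h_op \<phi> \<xi> Y
     + ev2 g (phi_h_op \<phi> \<xi> Y) Z \<odot> X - ev2 g (phi_h_op \<phi> \<xi> X) Z \<odot> Y"

end

theory Submission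
  imports Defs
begin

text \<open>
  Both statements are the cases \<open>\<alpha> = 0\<close> and \<open>\<alpha> = 1\<close> of one theorem about structures with \<open>d\<eta> = 0\<close> and
  \<open>d\<Phi> = 2\<alpha> \<eta> \<and> \<Phi>\<close>, for which the formula reads
  \<open>R = -(\<kappa> + 2\<alpha>\<^sup>2) R\<^sub>1 - 2(\<kappa> + \<alpha>\<^sup>2) R\<^sub>3 + \<mu> R\<^sub>4 + \<nu> R\<^sub>7\<close> (\<open>curvature_formula\<close>).
  The defining condition prescribes \<open>R(X,Y)\<xi>\<close>, hence by the symmetries of the curvature tensor every
  component with one argument \<open>\<xi>\<close>. In dimension three a single number is left: the sectional
  curvature of the plane orthogonal to \<open>\<xi>\<close>, which has to be \<open>-(\<kappa> + 2\<alpha>\<^sup>2)\<close>. On that plane \<open>R\<^sub>3\<close>, \<open>R\<^sub>4\<close>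
  and \<open>R\<^sub>7\<close> vanish, the last two because \<open>h\<close> and \<open>\<phi>h\<close> are symmetric and trace-free.

  As \<open>d\<eta> = 0\<close>, the plane field \<open>\<eta> = 0\<close> is integrable. Its leaves have the shape operator
  \<open>B = \<nabla>\<xi> = \<alpha> + S\<close> with \<open>S = -\<phi>h\<close> (\<open>shape0\<close>) symmetric and anticommuting with \<open>\<phi>\<close>, and the
  condition on \<open>R(X,\<xi>)\<xi>\<close> gives \<open>S\<^sup>2 = -(\<kappa> + \<alpha>\<^sup>2)\<close>, so that \<open>det B = \<kappa> + 2\<alpha>\<^sup>2\<close>. By the Gauss equation the claim is
  therefore that the leaves are flat (\<open>leaf_flat\<close>). To see this, let \<open>D\<close> be the Levi-Civita connection of
  the leaves. As \<open>R(X,Y)\<xi> = 0\<close> for horizontal fields, \<open>S\<close> is a Codazzi tensor: \<open>(D\<^sub>X S)Y\<close> is symmetric in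
  \<open>X\<close> and \<open>Y\<close>. The operator \<open>D\<^sub>X S\<close> also anticommutes with \<open>\<phi>\<close>, since \<open>D\<phi> = 0\<close> on a surface, and with \<open>S\<close>, since \<open>S\<^sup>2\<close> is
  constant along the leaves. Comparing the two ways of evaluating \<open>(D\<^bsub>\<phi>X\<^esub> S)(SY)\<close> gives \<open>DS = 0\<close>
  (\<open>leaf_deriv_shape0_eq_0\<close>). So the curvature of \<open>D\<close> is a skew operator that commutes with \<open>\<phi>\<close> and with \<open>S\<close>.
  As \<open>S\<close> is invertible and anticommutes with \<open>\<phi>\<close>, there is none but zero on a plane.

  All computations are with global vector fields, without local orthonormal frames. The dimension
  enters only through \<open>g(U,Z)V - g(V,Z)U = g(\<phi>U,V) \<phi>Z\<close> for horizontal vectors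
  (\<open>horizontal_plane_identity\<close>). This rests on the fact that the space of derivations at a point of an
  \<open>n\<close>-dimensional manifold has dimension at most \<open>n\<close>, which needs a smooth bump function and
  Hadamard's lemma.
\<close>

section \<open>Calculus of maps of class $C^n$\<close>

lemma Ck_on_SucD:
  assumes "Ck_on (Suc n) S f"
  shows "Ck_on n S f"
  using assms
proof (induction n arbitrary: f)
  case 0
  then have "f differentiable_on S"
    by (auto simp: differentiable_on_def intro: differentiable_at_withinI)
  then show ?case
    using differentiable_imp_continuous_on by (simp, blast)
next
  case (Suc n)
  then show ?case by simp
qed

lemma Ck_on_cong:
  assumes "open S" "\<And>x. x \<in> S \<Longrightarrow> f x = g x" "Ck_on n S f"
  shows "Ck_on n S g"
  using assms(2,3)
proof (induction n arbitrary: f g)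
  case 0
  then show ?case using continuous_on_cong by (metis Ck_on.simps(1))
next
  case (Suc n)
  have d: "(g has_derivative frechet_derivative f (at x)) (at x)" if "x \<in> S" for x
  proof (rule has_derivative_transform_within_open[OF _ assms(1) that])
    show "(f has_derivative frechet_derivative f (at x)) (at x)"
      using Suc.prems(2) that frechet_derivative_works by auto
  qed (use Suc.prems in auto)
  then have e: "frechet_derivative f (at x) = frechet_derivative g (at x)" if "x \<in> S" for x
    using frechet_derivative_at that by blast
  show ?case
    unfolding Ck_on.simps
  proof (intro conjI ballI allI)
    show "g differentiable at x" if "x \<in> S" for x
      using d[OF that] by (auto simp: differentiable_def)
    show "Ck_on n S (\<lambda>x. frechet_derivative g (at x) v)" for v
      using Suc.IH[of "\<lambda>x. frechet_derivative f (at x) v" "\<lambda>x. frechet_derivative g (at x) v"]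
        e Suc.prems(2) by auto
  qed
qed

text \<open>
  The definition of the class refers to the Frechet derivative as a choice; with this rule any
  explicit derivative can be used instead, because derivatives at interior points are unique.
\<close>

lemma Ck_on_SucI:
  assumes "open S" and d: "\<And>x. x \<in> S \<Longrightarrow> (f has_derivative f' x) (at x)"
    and "\<And>v. Ck_on n S (\<lambda>x. f' x v)"
  shows "Ck_on (Suc n) S f"
  unfolding Ck_on.simps
proof (intro conjI ballI allI)
  show "f differentiable at x" if "x \<in> S" for x
    using d[OF that] by (auto simp: differentiable_def)
  show "Ck_on n S (\<lambda>x. frechet_derivative f (at x) v)" for v
    using Ck_on_cong[OF assms(1) _ assms(3), of v] frechet_derivative_at[OF d] by auto
qed

lemma Ck_on_Suc_has_derivative:
  assumes "Ck_on (Suc n) S f" "x \<in> S"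
  shows "(f has_derivative frechet_derivative f (at x)) (at x)"
  using assms frechet_derivative_works by auto

lemma Ck_on_const: "open S \<Longrightarrow> Ck_on n S (\<lambda>x. c)"
proof (induction n arbitrary: c)
  case (Suc n)
  show ?case by (rule Ck_on_SucI[where f' = "\<lambda>_ _. 0"]) (use Suc in auto)
qed auto

lemma Ck_on_id: "open S \<Longrightarrow> Ck_on n S (\<lambda>x. x)"
proof (induction n)
  case (Suc n)
  show ?case by (rule Ck_on_SucI[where f' = "\<lambda>_ v. v"]) (use Suc Ck_on_const in auto)
qed auto

lemma Ck_on_bounded_linear:
  assumes "open S" "bounded_linear L" "Ck_on n S f"
  shows "Ck_on n S (\<lambda>x. L (f x))"
  using assms(3)
proof (induction n arbitrary: f)
  case 0
  then show ?case using bounded_linear.continuous_on[OF assms(2)] by simp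
next
  case (Suc n)
  show ?case
  proof (rule Ck_on_SucI[OF assms(1)])
    show "((\<lambda>x. L (f x)) has_derivative (\<lambda>v. L (frechet_derivative f (at x) v))) (at x)"
      if "x \<in> S" for x
      using bounded_linear.has_derivative[OF assms(2) Ck_on_Suc_has_derivative[OF Suc.prems that]] .
  qed (use Suc in auto)
qed

lemma Ck_on_add:
  assumes "open S" "Ck_on n S f" "Ck_on n S g"
  shows "Ck_on n S (\<lambda>x. f x + g x)"
  using assms(2,3)
proof (induction n arbitrary: f g)
  case 0
  then show ?case by (simp add: continuous_on_add)
next
  case (Suc n)
  show ?case
    by (rule Ck_on_SucI[OF assms(1) has_derivative_add])
      (use Suc in \<open>auto intro!: Ck_on_Suc_has_derivative\<close>)
qed

lemma Ck_on_sum: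
  assumes "open S" "finite I" "\<And>i. i \<in> I \<Longrightarrow> Ck_on n S (f i)"
  shows "Ck_on n S (\<lambda>x. \<Sum>i\<in>I. f i x)"
  using assms(2,3)
  by (induction I rule: finite_induct) (auto intro: Ck_on_const[OF assms(1)] Ck_on_add[OF assms(1)])

lemma Ck_on_mult:
  fixes f g :: "'a::euclidean_space \<Rightarrow> real"
  assumes "open S" "Ck_on n S f" "Ck_on n S g"
  shows "Ck_on n S (\<lambda>x. f x * g x)"
  using assms(2,3)
proof (induction n arbitrary: f g)
  case 0
  then show ?case by (simp add: continuous_on_mult)
next
  case (Suc n)
  show ?case
  proof (rule Ck_on_SucI[OF assms(1)])
    show "((\<lambda>x. f x * g x) has_derivative
        (\<lambda>v. f x * frechet_derivative g (at x) v + frechet_derivative f (at x) v * g x)) (at x)"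
      if "x \<in> S" for x
      using Suc.prems that by (intro has_derivative_mult Ck_on_Suc_has_derivative)
    show "Ck_on n S (\<lambda>x. f x * frechet_derivative g (at x) v + frechet_derivative f (at x) v * g x)"
      for v
      using Suc.prems Ck_on_SucD
      by (intro Ck_on_add Suc.IH assms(1)) (auto simp del: Ck_on.simps, auto)
  qed
qed

lemma Ck_on_subset: "Ck_on n S f \<Longrightarrow> T \<subseteq> S \<Longrightarrow> Ck_on n T f"
  by (induction n arbitrary: f) (auto intro: continuous_on_subset)

lemma Ck_on_Un: "open S \<Longrightarrow> open T \<Longrightarrow> Ck_on n S f \<Longrightarrow> Ck_on n T f \<Longrightarrow> Ck_on n (S \<union> T) f"
  by (induction n arbitrary: f) (auto intro: continuous_on_open_Un)

text \<open>
  The derivative of the outer map is expanded in the standard basis of the middle space, so that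
  the derivative of the composition is a sum of products of real functions and the induction on
  the order of differentiability goes through.
\<close>

lemma Ck_on_compose:
  fixes f :: "'b::euclidean_space \<Rightarrow> real" and g :: "'a::euclidean_space \<Rightarrow> 'b"
  assumes "open S" "open T" "g ` S \<subseteq> T" "Ck_on n T f" "Ck_on n S g"
  shows "Ck_on n S (\<lambda>x. f (g x))"
  using assms(4,5)
proof (induction n arbitrary: f)
  case 0
  then show ?case using assms(3) by (auto intro: continuous_on_compose2)
next
  case (Suc n)
  let ?f' = "\<lambda>x. frechet_derivative f (at x)" and ?g' = "\<lambda>x. frechet_derivative g (at x)"
  show ?case
  proof (rule Ck_on_SucI[OF assms(1)])
    show "((\<lambda>x. f (g x)) has_derivative
        (\<lambda>v. \<Sum>b\<in>Basis. (?g' x v \<bullet> b) * ?f' (g x) b)) (at x)" if "x \<in> S" for x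
    proof -
      have "g x \<in> T" using that assms(3) by auto
      note df = Ck_on_Suc_has_derivative[OF Suc.prems(1) this]
      have "(f \<circ> g has_derivative ?f' (g x) \<circ> ?g' x) (at x)"
        by (rule diff_chain_at[OF Ck_on_Suc_has_derivative[OF Suc.prems(2) that] df])
      moreover have "(?f' (g x) \<circ> ?g' x) v = (\<Sum>b\<in>Basis. (?g' x v \<bullet> b) * ?f' (g x) b)" for v
      proof -
        have "?f' (g x) (\<Sum>b\<in>Basis. (?g' x v \<bullet> b) *\<^sub>R b) =
            (\<Sum>b\<in>Basis. (?g' x v \<bullet> b) * ?f' (g x) b)"
          by (simp add: linear_sum[OF has_derivative_linear[OF df]]
              linear_cmul[OF has_derivative_linear[OF df]])
        then show ?thesis by (simp only: euclidean_representation o_apply)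
      qed
      then have "?f' (g x) \<circ> ?g' x = (\<lambda>v. \<Sum>b\<in>Basis. (?g' x v \<bullet> b) * ?f' (g x) b)" by blast
      ultimately show ?thesis by (simp only: o_def)
    qed
    show "Ck_on n S (\<lambda>x. \<Sum>b\<in>Basis. (?g' x v \<bullet> b) * ?f' (g x) b)" for v
    proof (intro Ck_on_sum[OF assms(1) finite_Basis] Ck_on_mult[OF assms(1)])
      fix b :: 'b
      show "Ck_on n S (\<lambda>x. ?g' x v \<bullet> b)"
        using Suc.prems(2) Ck_on_bounded_linear[OF assms(1) bounded_linear_inner_left, of n "\<lambda>x. ?g' x v"]
        by simp
      show "Ck_on n S (\<lambda>x. ?f' (g x) b)"
        by (rule Suc.IH[OF _ Ck_on_SucD[OF Suc.prems(2)]]) (use Suc.prems(1) in simp)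
    qed
  qed
qed

section \<open>A smooth bump function\<close>

text \<open>
  The powers \<open>t\<^sup>-\<^sup>m\<close> are included because this makes the family closed under differentiation.
\<close>

definition flat_exp :: "nat \<Rightarrow> real \<Rightarrow> real" where
  "flat_exp m t = (if t \<le> 0 then 0 else exp (- inverse t) * inverse t ^ m)"

lemma flat_exp_tendsto_0: "(flat_exp m \<longlongrightarrow> 0) (at 0)"
proof (rule filterlim_split_at)
  show "(flat_exp m \<longlongrightarrow> 0) (at_left 0)"
    by (rule tendsto_eventually) (simp add: eventually_at_left_field flat_exp_def, intro exI[of _ "-1"], simp)
  have "((\<lambda>t. inverse t ^ m / exp (inverse t)) \<longlongrightarrow> (0::real)) (at_right 0)"
    by (rule filterlim_compose[OF tendsto_power_div_exp_0 filterlim_inverse_at_top_right])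
  then show "(flat_exp m \<longlongrightarrow> 0) (at_right 0)"
    by (rule Lim_transform_eventually)
      (auto simp: eventually_at_right_field flat_exp_def exp_minus field_simps intro!: exI[of _ 1])
qed

text \<open>
  At \<open>0\<close> the difference quotient of the function with index \<open>m\<close> is the function with index \<open>m + 1\<close>,
  which tends to \<open>0\<close>.
\<close>

lemma flat_exp_has_derivative:
  "(flat_exp m has_real_derivative flat_exp (m + 2) t - real m * flat_exp (m + 1) t) (at t)"
proof (cases t "0 :: real" rule: linorder_cases)
  case less
  have "((\<lambda>_. 0) has_real_derivative 0) (at t)" by simp
  then have "(flat_exp m has_real_derivative 0) (at t)"
    by (rule has_field_derivative_transform_within_open[of _ _ _ "{..<0}"])
      (use less in \<open>auto simp: flat_exp_def\<close>)
  then show ?thesis using less by (simp add: flat_exp_def)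
next
  case equal
  have "((\<lambda>h. (flat_exp m h - flat_exp m 0) / (h - 0)) \<longlongrightarrow> 0) (at 0)"
    by (rule Lim_transform_eventually[OF flat_exp_tendsto_0[of "m + 1"]])
      (auto simp: flat_exp_def eventually_at_filter divide_inverse)
  then show ?thesis using equal by (simp add: has_field_derivative_iff flat_exp_def)
next
  case greater
  have "((\<lambda>t. exp (- inverse t) * inverse t ^ m) has_real_derivative
      exp (- inverse t) * (inverse t)\<^sup>2 * inverse t ^ m
      + exp (- inverse t) * (real m * inverse t ^ (m - 1) * - (inverse t)\<^sup>2)) (at t)"
    using greater by (auto intro!: derivative_eq_intros simp: power2_eq_square)
  also have "exp (- inverse t) * (inverse t)\<^sup>2 * inverse t ^ m
      + exp (- inverse t) * (real m * inverse t ^ (m - 1) * - (inverse t)\<^sup>2) =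
      flat_exp (m + 2) t - real m * flat_exp (m + 1) t"
    using greater by (cases m) (simp_all add: flat_exp_def algebra_simps power2_eq_square)
  finally have "((\<lambda>t. exp (- inverse t) * inverse t ^ m) has_real_derivative
      flat_exp (m + 2) t - real m * flat_exp (m + 1) t) (at t)" .
  then show ?thesis
    by (rule has_field_derivative_transform_within_open[of _ _ _ "{0<..}"])
      (use greater in \<open>auto simp: flat_exp_def\<close>)
qed

lemma Ck_on_flat_exp_of_ball: "Ck_on n UNIV (\<lambda>x::'a::euclidean_space. flat_exp m (r\<^sup>2 - (x - a) \<bullet> (x - a)))"
proof (induction n arbitrary: m)
  case 0
  have "continuous_on UNIV (flat_exp m)"
    using flat_exp_has_derivative DERIV_isCont continuous_at_imp_continuous_on by blast
  then show ?case
    by simp (rule continuous_on_compose2[of UNIV "flat_exp m"], auto intro!: continuous_intros)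
next
  case (Suc n)
  let ?q = "\<lambda>x. r\<^sup>2 - (x - a) \<bullet> (x - a)"
  have lin: "Ck_on n UNIV (\<lambda>x::'a. - 2 * (v \<bullet> (x - a)))" for v
  proof -
    have "bounded_linear (\<lambda>y. - 2 * (v \<bullet> y))"
      by (intro bounded_linear_const_mult bounded_linear_inner_right)
    from Ck_on_bounded_linear[OF open_UNIV this Ck_on_add[OF open_UNIV Ck_on_id Ck_on_const], of n "- a"]
    show ?thesis by simp
  qed
  show ?case
  proof (rule Ck_on_SucI[OF open_UNIV])
    have q: "(?q has_derivative (\<lambda>v. - 2 * (v \<bullet> (x - a)))) (at x)" for x
      by (auto intro!: derivative_eq_intros simp: inner_commute)
    have f: "(flat_exp m has_derivative (\<lambda>s. s * (flat_exp (m + 2) t - real m * flat_exp (m + 1) t))) (at t)"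
      for t
      using flat_exp_has_derivative[of m t] by (simp add: has_field_derivative_def mult_commute_abs)
    show "((\<lambda>x. flat_exp m (?q x)) has_derivative
        (\<lambda>v. (- 2 * (v \<bullet> (x - a))) * (flat_exp (m + 2) (?q x) + - real m * flat_exp (m + 1) (?q x)))) (at x)"
      for x
      using diff_chain_at[OF q f, of x] by (simp add: o_def)
    show "Ck_on n UNIV (\<lambda>x. (- 2 * (v \<bullet> (x - a))) *
        (flat_exp (m + 2) (?q x) + - real m * flat_exp (m + 1) (?q x)))" for v
      by (intro Ck_on_mult Ck_on_add lin Suc.IH Ck_on_const open_UNIV)
  qed
qed

lemma smooth_bump_exists:
  fixes a :: "'a::euclidean_space"
  assumes "r > 0"
  obtains \<beta> :: "'a \<Rightarrow> real"
  where "smooth_on UNIV \<beta>" "\<beta> a = 1" "\<And>x. x \<notin> cball a r \<Longrightarrow> \<beta> x = 0"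
proof
  let ?b = "\<lambda>x. inverse (flat_exp 0 (r\<^sup>2)) * flat_exp 0 (r\<^sup>2 - (x - a) \<bullet> (x - a))"
  show "smooth_on UNIV ?b"
    unfolding smooth_on_def by (intro allI Ck_on_mult Ck_on_const Ck_on_flat_exp_of_ball open_UNIV)
  show "?b a = 1" using assms by (simp add: flat_exp_def)
  show "?b x = 0" if "x \<notin> cball a r" for x
  proof -
    have "r < norm (x - a)" using that by (simp add: dist_norm norm_minus_commute)
    then have "r\<^sup>2 \<le> (norm (x - a))\<^sup>2" using assms by (intro power_mono) auto
    then show ?thesis by (simp add: flat_exp_def power2_norm_eq_inner)
  qed
qed

section \<open>Hadamard's lemma\<close>

text \<open>
  Differentiation under the integral sign produces an integral of the same kind, with the exponent
  \<open>k\<close> raised by one and \<open>F\<close> replaced by a directional derivative. This is why the weight \<open>t\<^sup>k\<close> is there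
  although Hadamard's lemma only uses \<open>k = 0\<close>.
\<close>

lemma Ck_on_integral_along_rays:
  fixes F :: "'a::euclidean_space \<Rightarrow> real"
  assumes S: "open S" "convex S" "a \<in> S" and "smooth_on S F"
  shows "Ck_on n S (\<lambda>x. integral {0..1} (\<lambda>t. t ^ k * F (a + t *\<^sub>R (x - a))))"
  using assms(4)
proof (induction n arbitrary: F k)
  case 0
  then have F: "continuous_on S F" unfolding smooth_on_def by (metis Ck_on.simps(1))
  have in_S: "a + t *\<^sub>R (x - a) \<in> S" if "x \<in> S" "t \<in> {0..1}" for x t
    using convexD_alt[OF S(2,3) that(1), of t] that by (simp add: algebra_simps)
  have "continuous_on (S \<times> cbox 0 1) (\<lambda>(x, t). t ^ k * F (a + t *\<^sub>R (x - a)))"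
    unfolding split_beta
    by (intro continuous_intros continuous_on_compose2[OF F]) (auto intro!: in_S)
  then show ?case using integral_continuous_on_param by fastforce
next
  case (Suc n)
  let ?D = "\<lambda>x. frechet_derivative F (at x)"
  have in_S: "a + t *\<^sub>R (x - a) \<in> S" if "x \<in> S" "t \<in> {0..1}" for x t
    using convexD_alt[OF S(2,3) that(1), of t] that by (simp add: algebra_simps)
  have smooth: "Ck_on m S F" for m using Suc.prems by (simp add: smooth_on_def)
  have dF: "(F has_derivative ?D x) (at x)" if "x \<in> S" for x
    using Ck_on_Suc_has_derivative[OF smooth that] .
  have smooth': "smooth_on S (\<lambda>x. ?D x v)" for v
    using smooth Ck_on.simps(2) unfolding smooth_on_def by metis
  then have contD: "continuous_on S (\<lambda>x. ?D x v)" for v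
    unfolding smooth_on_def by (metis Ck_on.simps(1))
  have F: "continuous_on S F" using smooth[of 0] by simp
  define L where "L x t = Blinfun (\<lambda>v. t ^ Suc k * ?D (a + t *\<^sub>R (x - a)) v)" for x and t :: real
  have L: "blinfun_apply (L x t) = (\<lambda>v. t ^ Suc k * ?D (a + t *\<^sub>R (x - a)) v)"
    if "x \<in> S" "t \<in> {0..1}" for x t
    unfolding L_def
    by (rule bounded_linear_Blinfun_apply)
      (intro bounded_linear_const_mult has_derivative_bounded_linear[OF dF] in_S that)
  have contL: "continuous_on (S \<times> {0..1}) (\<lambda>(x, t). L x t)"
  proof (rule continuous_on_blinfun_componentwise)
    fix i :: 'a
    have "continuous_on (S \<times> {0..1}) (\<lambda>(x, t). t ^ Suc k * ?D (a + t *\<^sub>R (x - a)) i)"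
      unfolding split_beta
      by (intro continuous_intros continuous_on_compose2[OF contD]) (auto intro!: in_S)
    then show "continuous_on (S \<times> {0..1}) (\<lambda>z. blinfun_apply (case z of (x, t) \<Rightarrow> L x t) i)"
      by (rule continuous_on_cong[THEN iffD1, rotated 2]) (auto simp: L)
  qed
  show ?case
  proof (rule Ck_on_SucI[OF S(1)])
    show "((\<lambda>x. integral {0..1} (\<lambda>t. t ^ k * F (a + t *\<^sub>R (x - a)))) has_derivative
        (\<lambda>v. integral {0..1} (\<lambda>t. t ^ Suc k * ?D (a + t *\<^sub>R (x - a)) v))) (at x)"
      if x: "x \<in> S" for x
    proof -
      have "((\<lambda>x. integral (cbox 0 1) (\<lambda>t. t ^ k * F (a + t *\<^sub>R (x - a)))) has_derivative
          integral (cbox 0 1) (L x)) (at x within S)"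
      proof (rule leibniz_rule[OF _ _ _ x S(2)])
        show "((\<lambda>x. t ^ k * F (a + t *\<^sub>R (x - a))) has_derivative blinfun_apply (L y t)) (at y within S)"
          if "y \<in> S" "t \<in> cbox 0 1" for y t
        proof -
          have "((\<lambda>x. a + t *\<^sub>R (x - a)) has_derivative (\<lambda>v. t *\<^sub>R v)) (at y)"
            by (auto intro!: derivative_eq_intros)
          from diff_chain_at[OF this dF[OF in_S]] that
          have d: "((\<lambda>x. F (a + t *\<^sub>R (x - a))) has_derivative
              (\<lambda>v. ?D (a + t *\<^sub>R (y - a)) (t *\<^sub>R v))) (at y)"
            by (simp add: o_def)
          have "?D (a + t *\<^sub>R (y - a)) (t *\<^sub>R v) = t * ?D (a + t *\<^sub>R (y - a)) v" for v
            using linear_cmul[OF has_derivative_linear[OF dF[OF in_S]]] that by simp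
          then have "((\<lambda>x. t ^ k * F (a + t *\<^sub>R (x - a))) has_derivative
              (\<lambda>v. t ^ Suc k * ?D (a + t *\<^sub>R (y - a)) v)) (at y)"
            using has_derivative_mult_right[OF d, of "t ^ k"] by (simp add: ac_simps)
          then show ?thesis using L that by (auto intro: has_derivative_at_withinI)
        qed
        show "(\<lambda>t. t ^ k * F (a + t *\<^sub>R (y - a))) integrable_on cbox 0 1" if "y \<in> S" for y
          by (rule integrable_continuous)
            (intro continuous_intros continuous_on_compose2[OF F], auto intro!: in_S that)
        show "continuous_on (S \<times> cbox 0 1) (\<lambda>(x, t). L x t)" using contL by simp
      qed
      moreover have "blinfun_apply (integral {0..1} (L x)) =
          (\<lambda>v. integral {0..1} (\<lambda>t. t ^ Suc k * ?D (a + t *\<^sub>R (x - a)) v))"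
      proof
        fix v
        have "continuous_on {0..1} (\<lambda>t. (\<lambda>(x, t). L x t) (x, t))"
          by (rule continuous_on_compose2[OF contL]) (auto intro!: continuous_intros x)
        then have "L x integrable_on {0..1}"
          by (simp add: integrable_continuous_real)
        then have "blinfun_apply (integral {0..1} (L x)) v = integral {0..1} (\<lambda>t. blinfun_apply (L x t) v)"
          by (rule blinfun_apply_integral)
        also have "\<dots> = integral {0..1} (\<lambda>t. t ^ Suc k * ?D (a + t *\<^sub>R (x - a)) v)"
          by (rule integral_cong) (simp add: L x)
        finally show "blinfun_apply (integral {0..1} (L x)) v =
            integral {0..1} (\<lambda>t. t ^ Suc k * ?D (a + t *\<^sub>R (x - a)) v)" .
      qed
      ultimately show ?thesis using at_within_open[OF x S(1)] by simp
    qed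
    show "Ck_on n S (\<lambda>x. integral {0..1} (\<lambda>t. t ^ Suc k * ?D (a + t *\<^sub>R (x - a)) v))" for v
      by (rule Suc.IH[OF smooth'])
  qed
qed

text \<open>
  The factor of \<open>(x - a) \<bullet> b\<close> is the mean value of the partial derivative of \<open>f\<close> in direction \<open>b\<close> on
  the segment from \<open>a\<close> to \<open>x\<close>, by the fundamental theorem of calculus along that segment.
\<close>

lemma Hadamard:
  fixes f :: "'a::euclidean_space \<Rightarrow> real"
  assumes S: "open S" "convex S" "a \<in> S" and f: "smooth_on S f"
  obtains G where "\<And>b. smooth_on S (G b)"
    "\<And>x. x \<in> S \<Longrightarrow> f x = f a + (\<Sum>b\<in>Basis. ((x - a) \<bullet> b) * G b x)"
proof
  let ?D = "\<lambda>x. frechet_derivative f (at x)"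
  let ?G = "\<lambda>b x. integral {0..1} (\<lambda>t. t ^ 0 * ?D (a + t *\<^sub>R (x - a)) b)"
  have smooth: "Ck_on m S f" for m using f by (simp add: smooth_on_def)
  have df: "(f has_derivative ?D x) (at x)" if "x \<in> S" for x
    using Ck_on_Suc_has_derivative[OF smooth that] .
  have smooth': "smooth_on S (\<lambda>x. ?D x v)" for v
    using smooth Ck_on.simps(2) unfolding smooth_on_def by metis
  then have contD: "continuous_on S (\<lambda>x. ?D x v)" for v
    unfolding smooth_on_def by (metis Ck_on.simps(1))
  show "smooth_on S (?G b)" for b
    unfolding smooth_on_def[of S "?G b"]
    by (intro allI Ck_on_integral_along_rays[OF S smooth'])
  show "f x = f a + (\<Sum>b\<in>Basis. ((x - a) \<bullet> b) * ?G b x)" if x: "x \<in> S" for x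
  proof -
    have in_S: "a + t *\<^sub>R (x - a) \<in> S" if "t \<in> {0..1}" for t
      using convexD_alt[OF S(2,3) x, of t] that by (simp add: algebra_simps)
    have "((\<lambda>t. f (a + t *\<^sub>R (x - a))) has_vector_derivative ?D (a + t *\<^sub>R (x - a)) (x - a))
        (at t within {0..1})" if "t \<in> {0..1}" for t
    proof -
      have "((\<lambda>t. a + t *\<^sub>R (x - a)) has_derivative (\<lambda>s. s *\<^sub>R (x - a))) (at t)"
        by (auto intro!: derivative_eq_intros)
      from diff_chain_at[OF this df[OF in_S[OF that]]]
      have "((\<lambda>t. f (a + t *\<^sub>R (x - a))) has_derivative
          (\<lambda>s. ?D (a + t *\<^sub>R (x - a)) (s *\<^sub>R (x - a)))) (at t)"
        by (simp add: o_def)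
      moreover have "?D (a + t *\<^sub>R (x - a)) (s *\<^sub>R (x - a)) = s *\<^sub>R ?D (a + t *\<^sub>R (x - a)) (x - a)" for s
        using linear_cmul[OF has_derivative_linear[OF df[OF in_S]]] that by simp
      ultimately show ?thesis
        by (simp add: has_vector_derivative_def has_derivative_at_withinI)
    qed
    from fundamental_theorem_of_calculus[OF _ this]
    have "((\<lambda>t. ?D (a + t *\<^sub>R (x - a)) (x - a)) has_integral f x - f a) {0..1}" by simp
    then have "f x - f a = integral {0..1} (\<lambda>t. ?D (a + t *\<^sub>R (x - a)) (x - a))"
      by (simp add: integral_unique)
    also have "\<dots> = integral {0..1} (\<lambda>t. \<Sum>b\<in>Basis. ((x - a) \<bullet> b) * ?D (a + t *\<^sub>R (x - a)) b)"
    proof (rule integral_cong)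
      fix t :: real assume "t \<in> {0..1}"
      then have lin: "linear (?D (a + t *\<^sub>R (x - a)))" using has_derivative_linear[OF df[OF in_S]] by simp
      have "?D (a + t *\<^sub>R (x - a)) (\<Sum>b\<in>Basis. ((x - a) \<bullet> b) *\<^sub>R b) =
          (\<Sum>b\<in>Basis. ((x - a) \<bullet> b) * ?D (a + t *\<^sub>R (x - a)) b)"
        by (simp add: linear_sum[OF lin] linear_cmul[OF lin])
      then show "?D (a + t *\<^sub>R (x - a)) (x - a) =
          (\<Sum>b\<in>Basis. ((x - a) \<bullet> b) * ?D (a + t *\<^sub>R (x - a)) b)"
        by (simp only: euclidean_representation)
    qed
    also have "\<dots> = (\<Sum>b\<in>Basis. integral {0..1} (\<lambda>t. ((x - a) \<bullet> b) * ?D (a + t *\<^sub>R (x - a)) b))"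
      by (rule integral_sum)
        (auto intro!: integrable_continuous_real continuous_intros continuous_on_compose2[OF contD] in_S)
    finally show ?thesis by simp
  qed
qed

section \<open>The dimension of the tangent spaces\<close>

lemma smooth_fun_iff:
  "smooth_fun A f \<longleftrightarrow> (\<forall>(U, \<psi>)\<in>A. \<forall>n. Ck_on n (\<psi> ` U) (\<lambda>x. f (inv_into U \<psi> x)))"
  by (simp add: smooth_fun_def smooth_on_def o_def)

lemma open_chart_image: "smooth_manifold A \<Longrightarrow> (U, \<psi>) \<in> A \<Longrightarrow> open (\<psi> ` U)"
  using smooth_manifold.charts by blast

lemma smooth_fun_const: "smooth_manifold A \<Longrightarrow> smooth_fun A (\<lambda>_. c)"
  unfolding smooth_fun_iff by (auto intro!: Ck_on_const open_chart_image)

lemma smooth_fun_add: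
  "smooth_manifold A \<Longrightarrow> smooth_fun A f \<Longrightarrow> smooth_fun A f' \<Longrightarrow> smooth_fun A (f + f')"
  unfolding smooth_fun_iff plus_fun_apply by (auto intro!: Ck_on_add open_chart_image)

lemma smooth_fun_mult:
  "smooth_manifold A \<Longrightarrow> smooth_fun A f \<Longrightarrow> smooth_fun A f' \<Longrightarrow> smooth_fun A (f * f')"
  unfolding smooth_fun_iff times_fun_apply by (auto intro!: Ck_on_mult open_chart_image)

lemma sum_fun_apply: "(\<Sum>i\<in>I. f i) x = (\<Sum>i\<in>I. f i x)"
  by (induction I rule: infinite_finite_induct) auto

lemma smooth_fun_sum:
  assumes "smooth_manifold A" "finite I" "\<And>i. i \<in> I \<Longrightarrow> smooth_fun A (f i)"
  shows "smooth_fun A (\<Sum>i\<in>I. f i)"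
  using assms(2,3)
proof (induction I rule: finite_induct)
  case empty
  then show ?case using smooth_fun_const[OF assms(1), of 0] by (simp add: zero_fun_def)
qed (simp add: smooth_fun_add[OF assms(1)])

text \<open>
  Inside the chart the function is smooth by the chain rule. The complement of the compact support
  \<open>?K\<close> is open because the manifold is Hausdorff, and the function vanishes there; these two open sets
  cover every chart domain.
\<close>

lemma smooth_fun_extend_by_zero:
  fixes A :: "('m::{t2_space, second_countable_topology}, 'e::euclidean_space) chart set"
  assumes M: "smooth_manifold A" and U: "(U, \<psi>) \<in> A"
    and r: "r < R" "ball a R \<subseteq> \<psi> ` U"
    and \<beta>: "smooth_on UNIV \<beta>" "\<And>x. x \<notin> cball a r \<Longrightarrow> \<beta> x = (0::real)"
    and F: "smooth_on (ball a R) F"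
  shows "smooth_fun A (\<lambda>q. if q \<in> U then \<beta> (\<psi> q) * F (\<psi> q) else 0)" (is "smooth_fun A ?f")
proof -
  interpret smooth_manifold A by (rule M)
  let ?H = "\<lambda>x. \<beta> x * F x"
  have H: "Ck_on n UNIV ?H" for n
  proof -
    have "Ck_on n (ball a R) ?H"
      using \<beta>(1) F by (auto simp: smooth_on_def intro!: Ck_on_mult intro: Ck_on_subset)
    moreover have "Ck_on n (- cball a r) ?H"
      by (rule Ck_on_cong[where f = "\<lambda>_. 0", OF _ _ Ck_on_const]) (use \<beta>(2) in \<open>auto simp: open_Compl\<close>)
    ultimately have "Ck_on n (ball a R \<union> - cball a r) ?H"
      by (intro Ck_on_Un) (auto simp: open_Compl)
    moreover have "ball a R \<union> - cball a r = UNIV" using r(1) by (auto simp: not_less)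
    ultimately show ?thesis by simp
  qed
  have inj: "inj_on \<theta> V" and oV: "open V" and oimg: "open (\<theta> ` V)"
    and cont: "continuous_on V \<theta>" "continuous_on (\<theta> ` V) (inv_into V \<theta>)"
    if "(V, \<theta>) \<in> A" for V \<theta>
    using charts[OF that] by (auto simp: homeomorphism_def intro: inj_on_inverseI)
  have open_image: "open (\<theta> ` W)" if "(V, \<theta>) \<in> A" "open W" "W \<subseteq> V" for V \<theta> W
  proof -
    have "openin (top_of_set (\<theta> ` V)) (\<theta> ` W)"
      using charts[OF that(1)] that(2,3)
      by (meson homeomorphism_imp_open_map open_openin openin_open_eq openin_subset_trans
          open_subset oV that(1))
    then show ?thesis using oimg[OF that(1)] openin_open_trans by blast
  qed
  \<comment> \<open>The support of the extended function, pulled back to the manifold.\<close>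
  let ?K = "inv_into U \<psi> ` cball a r"
  have sub: "cball a r \<subseteq> \<psi> ` U"
    by (rule order_trans[OF _ r(2)]) (use r(1) in auto)
  have closed: "closed ?K"
    by (intro compact_imp_closed compact_continuous_image compact_cball
        continuous_on_subset[OF cont(2)[OF U] sub])
  have f0: "?f q = 0" if "q \<notin> ?K" for q
  proof (cases "q \<in> U")
    case True
    then have "\<psi> q \<notin> cball a r" using that inj[OF U] by (metis imageI inv_into_f_f)
    then show ?thesis using \<beta>(2) by simp
  qed simp
  have "Ck_on n (\<theta> ` V) (?f \<circ> inv_into V \<theta>)" if V: "(V, \<theta>) \<in> A" for V \<theta> n
  proof -
    have inv: "inv_into V \<theta> (\<theta> q) = q" if "q \<in> V" for q using inj[OF V] that by simp
    have 1: "open (\<theta> ` (V \<inter> U))" "open (\<theta> ` (V - ?K))"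
      using oV[OF V] oV[OF U] closed by (auto intro!: open_image[OF V])
    have "Ck_on n (\<theta> ` (V \<inter> U)) (\<lambda>x. ?H ((\<psi> \<circ> inv_into V \<theta>) x))"
      using compatible[OF V U] unfolding smooth_on_def
      by (intro Ck_on_compose[OF 1(1) open_UNIV subset_UNIV H]) blast
    then have "Ck_on n (\<theta> ` (V \<inter> U)) (?f \<circ> inv_into V \<theta>)"
      by (rule Ck_on_cong[OF 1(1), rotated]) (auto simp: inv)
    moreover have "Ck_on n (\<theta> ` (V - ?K)) (?f \<circ> inv_into V \<theta>)"
    proof (rule Ck_on_cong[OF 1(2) _ Ck_on_const[OF 1(2)]])
      show "0 = (?f \<circ> inv_into V \<theta>) x" if x: "x \<in> \<theta> ` (V - ?K)" for x
      proof -
        obtain q where q: "x = \<theta> q" "q \<in> V" "q \<notin> ?K" using x by blast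
        then show ?thesis using f0[OF q(3)] by (simp only: o_apply inv)
      qed
    qed
    moreover have "\<theta> ` (V \<inter> U) \<union> \<theta> ` (V - ?K) = \<theta> ` V"
    proof -
      have "?K \<subseteq> U" using sub by (auto intro: inv_into_into)
      then have "(V \<inter> U) \<union> (V - ?K) = V" by blast
      then show ?thesis by (metis image_Un)
    qed
    ultimately show ?thesis using Ck_on_Un[OF 1] by metis
  qed
  then show ?thesis by (auto simp: smooth_fun_def smooth_on_def)
qed

text \<open>
  Let \<open>\<chi>\<close> be a bump function with \<open>\<chi>(p) = 1\<close>. Multiplying the Hadamard decomposition of \<open>f - f(p)\<close> by \<open>\<chi>\<^sup>2\<close>
  gives the global identity \<open>\<chi>\<^sup>2 (f - f(p)) = \<Sum> (\<chi> (x\<^sub>b - a\<^sub>b)) (\<chi> g\<^sub>b)\<close>. Since the first factors vanish at \<open>p\<close>,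
  a derivation at \<open>p\<close> takes the right-hand side to a combination of its values on the functions
  \<open>y\<^sub>b = \<chi> (x\<^sub>b - a\<^sub>b)\<close>, and the left-hand side to its value on \<open>f\<close>.
\<close>

lemma tangent_vector_determined_by_coordinates:
  fixes A :: "('m::{t2_space, second_countable_topology}, 'e::euclidean_space) chart set"
  assumes M: "smooth_manifold A"
  obtains y :: "'e \<Rightarrow> 'm \<Rightarrow> real"
  where "\<And>v. v \<in> tangent_space A p \<Longrightarrow> (\<And>b. b \<in> Basis \<Longrightarrow> v (y b) = 0) \<Longrightarrow> v = 0"
proof -
  interpret smooth_manifold A by (rule M)
  obtain U \<psi> where U: "(U, \<psi>) \<in> A" "p \<in> U" using covering by fastforce
  let ?a = "\<psi> p"
  have "open (\<psi> ` U)" "?a \<in> \<psi> ` U" using charts[OF U(1)] U(2) by auto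
  then obtain R where R: "R > 0" "ball ?a R \<subseteq> \<psi> ` U" using open_contains_ball by blast
  then have r: "R / 2 > 0" "R / 2 < R" by auto
  obtain \<beta> where \<beta>: "smooth_on UNIV \<beta>" "\<beta> ?a = (1::real)" "\<And>x. x \<notin> cball ?a (R / 2) \<Longrightarrow> \<beta> x = 0"
    using smooth_bump_exists[OF r(1)] by metis
  define ext where "ext F = (\<lambda>q. if q \<in> U then \<beta> (\<psi> q) * F (\<psi> q) else 0)" for F
  have ext: "smooth_fun A (ext F)" if "smooth_on (ball ?a R) F" for F
    unfolding ext_def by (rule smooth_fun_extend_by_zero[OF M U(1) r(2) R(2) \<beta>(1,3) that])
  define y where "y b = ext (\<lambda>x. (x - ?a) \<bullet> b)" for b
  have y: "smooth_fun A (y b)" for b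
    unfolding y_def
  proof (rule ext)
    have "Ck_on n (ball ?a R) (\<lambda>x. (x + - ?a) \<bullet> b)" for n
      by (rule Ck_on_bounded_linear[OF open_ball bounded_linear_inner_left])
        (intro Ck_on_add Ck_on_id Ck_on_const open_ball)
    then show "smooth_on (ball ?a R) (\<lambda>x. (x - ?a) \<bullet> b)"
      by (simp add: smooth_on_def)
  qed
  have "v = 0" if v: "v \<in> tangent_space A p" and 0: "\<And>b. b \<in> Basis \<Longrightarrow> v (y b) = 0" for v
  proof (rule HOL.ext, simp)
    fix f
    have add: "v (f + f') = v f + v f'" and scale: "v (c *\<^sub>R f) = c * v f"
      and mult: "v (f * f') = f p * v f' + f' p * v f"
      if "smooth_fun A f" "smooth_fun A f'" for f f' c
      using v that by (auto simp: tangent_space_def linear_on_def)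
    have const: "v (\<lambda>_. c) = 0" for c
    proof -
      let ?one = "(\<lambda>_. 1) :: 'm \<Rightarrow> real"
      have one: "smooth_fun A ?one" by (rule smooth_fun_const[OF M])
      have "?one * ?one = ?one" by (simp add: fun_eq_iff)
      with mult[OF one one] have "v ?one = 0" by simp
      moreover have "(\<lambda>_. c) = c *\<^sub>R ?one" by (simp add: fun_eq_iff)
      ultimately show ?thesis using scale[OF one one, of c] by simp
    qed
    show "v f = 0"
    proof (cases "smooth_fun A f")
      case False
      then show ?thesis using v by (simp add: tangent_space_def)
    next
      case True
      then have "smooth_on (\<psi> ` U) (f \<circ> inv_into U \<psi>)"
        using U(1) by (auto simp: smooth_fun_def)
      then have near: "smooth_on (ball ?a R) (f \<circ> inv_into U \<psi>)"
        using R(2) Ck_on_subset unfolding smooth_on_def by blast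
      have centre: "?a \<in> ball ?a R" using R(1) by simp
      obtain G where G: "\<And>b. smooth_on (ball ?a R) (G b)"
        "\<And>x. x \<in> ball ?a R \<Longrightarrow> (f \<circ> inv_into U \<psi>) x = (f \<circ> inv_into U \<psi>) ?a
            + (\<Sum>b\<in>Basis. ((x - ?a) \<bullet> b) * G b x)"
        using that by (rule Hadamard[OF open_ball convex_ball centre near])
      have inj: "inj_on \<psi> U"
        using charts[OF U(1)] by (auto simp: homeomorphism_def intro: inj_on_inverseI)
      have f_near: "f q = f p + (\<Sum>b\<in>Basis. ((\<psi> q - ?a) \<bullet> b) * G b (\<psi> q))"
        if "q \<in> U" "\<psi> q \<in> ball ?a R" for q
        using G(2)[OF that(2)] by (simp only: o_apply inv_into_f_f[OF inj that(1)] inv_into_f_f[OF inj U(2)])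
      let ?\<chi> = "ext (\<lambda>_. 1)"
      have \<chi>: "smooth_fun A ?\<chi>" "?\<chi> p = 1"
        using ext[of "\<lambda>_. 1"] U(2) \<beta>(2) Ck_on_const by (auto simp: smooth_on_def ext_def)
      let ?g = "f + (\<lambda>_. - f p)"
      have g: "smooth_fun A ?g" "?g p = 0" "v ?g = v f"
        using smooth_fun_add[OF M True smooth_fun_const[OF M]] add[OF True smooth_fun_const[OF M]] const
        by auto
      have "?\<chi> * ?\<chi> * ?g = (\<Sum>b\<in>Basis. y b * ext (G b))"
      proof
        fix q
        show "(?\<chi> * ?\<chi> * ?g) q = (\<Sum>b\<in>Basis. y b * ext (G b)) q"
        proof (cases "q \<in> U \<and> \<psi> q \<in> ball ?a R")
          case True
          then have "?g q = (\<Sum>b\<in>Basis. ((\<psi> q - ?a) \<bullet> b) * G b (\<psi> q))" using f_near by simp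
          then show ?thesis using True
            by (simp add: sum_fun_apply ext_def y_def sum_distrib_left ac_simps)
        next
          case False
          then have "q \<in> U \<Longrightarrow> \<beta> (\<psi> q) = 0" using r by (intro \<beta>(3)) auto
          then show ?thesis by (auto simp: sum_fun_apply ext_def y_def)
        qed
      qed
      moreover have "v (?\<chi> * ?\<chi> * ?g) = v f"
        using mult[OF smooth_fun_mult[OF M \<chi>(1) \<chi>(1)] g(1)] g \<chi> by simp
      moreover have "v (\<Sum>b\<in>I. y b * ext (G b)) = 0" if "I \<subseteq> Basis" "finite I" for I
        using that(2,1)
      proof (induction I rule: finite_induct)
        case empty
        then show ?case using const[of 0] by (simp add: zero_fun_def)
      next
        case (insert b I)
        have "y b p = 0" using U(2) by (simp add: y_def ext_def)
        then have "v (y b * ext (G b)) = 0"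
          using mult[OF y ext[OF G(1)]] 0[of b] insert.prems by simp
        moreover have sm: "smooth_fun A (y b * ext (G b))" for b
          by (intro smooth_fun_mult[OF M] y ext G)
        moreover have "v (\<Sum>b\<in>I. y b * ext (G b)) = 0"
          using insert.prems by (intro insert.IH) simp
        moreover have "v (y b * ext (G b) + (\<Sum>b\<in>I. y b * ext (G b))) =
            v (y b * ext (G b)) + v (\<Sum>b\<in>I. y b * ext (G b))"
          by (rule add[OF sm smooth_fun_sum[OF M insert.hyps(1) sm]])
        ultimately show ?case
          unfolding sum.insert[OF insert.hyps] by linarith
      qed
      ultimately show ?thesis by (metis finite_Basis order_refl)
    qed
  qed
  then show ?thesis using that by blast
qed

lemma tangent_space_subspace:
  assumes "smooth_manifold A"
  shows "subspace (tangent_space A p)"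
  unfolding subspace_def tangent_space_def linear_on_def
  by (auto simp: algebra_simps)

lemma independent_in_tangent_space:
  fixes A :: "('m::{t2_space, second_countable_topology}, 'e::euclidean_space) chart set"
  assumes M: "smooth_manifold A" and B: "B \<subseteq> tangent_space A p" "independent B"
  shows "card B \<le> DIM('e)"
proof -
  obtain y :: "'e \<Rightarrow> 'm \<Rightarrow> real" where
    y: "\<And>v. v \<in> tangent_space A p \<Longrightarrow> (\<And>b. b \<in> Basis \<Longrightarrow> v (y b) = 0) \<Longrightarrow> v = 0"
    using tangent_vector_determined_by_coordinates[OF M] by blast
  let ?L = "\<lambda>v :: 'm tvec. \<Sum>b\<in>Basis. v (y b) *\<^sub>R b"
  have lin: "linear ?L"
    by (rule linearI) (simp_all add: sum.distrib scaleR_add_left scaleR_sum_right)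
  have sub: "span B \<subseteq> tangent_space A p"
    by (rule span_minimal[OF B(1) tangent_space_subspace[OF M]])
  have "inj_on ?L (span B)"
    unfolding linear_inj_on_iff_eq_0[OF lin subspace_span]
  proof (intro ballI impI)
    fix v assume v: "v \<in> span B" and 0: "?L v = 0"
    show "v = 0"
    proof (rule y)
      show "v (y b) = 0" if "b \<in> Basis" for b
      proof -
        have "v (y b) = ?L v \<bullet> b" using that by (simp add: inner_sum_left inner_Basis if_distrib cong: if_cong)
        then show ?thesis using 0 by simp
      qed
    qed (use v sub in auto)
  qed
  then have "independent (?L ` B)" "inj_on ?L B"
    using linear_independent_injective_image[OF lin B(2)] inj_on_subset[OF _ span_superset]
    by blast+
  then show ?thesis using independent_bound[of "?L ` B"] by (simp add: card_image)
qed

section \<open>Vector fields as a module over the functions\<close>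

lemma fscale_add_right: "a \<odot> (X + Y) = a \<odot> X + a \<odot> Y"
  and fscale_diff_right: "a \<odot> (X - Y) = a \<odot> X - a \<odot> Y"
  and fscale_minus_right: "a \<odot> (- X) = - (a \<odot> X)"
  and fscale_zero_right: "a \<odot> 0 = 0"
  and fscale_add_left: "(a + b) \<odot> X = a \<odot> X + b \<odot> X"
  and fscale_diff_left: "(a - b) \<odot> X = a \<odot> X - b \<odot> X"
  and fscale_minus_left: "(- a) \<odot> X = - (a \<odot> X)"
  and fscale_zero_left: "0 \<odot> X = 0"
  and fscale_one: "1 \<odot> X = X"
  and fscale_fscale: "a \<odot> (b \<odot> X) = (a * b) \<odot> X"
  by (simp_all add: fun_eq_iff fscale_def algebra_simps)

lemmas fscale_simps = fscale_add_right fscale_diff_right fscale_minus_right fscale_zero_right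
  fscale_add_left fscale_diff_left fscale_minus_left fscale_zero_left fscale_one fscale_fscale

lemma linear_on_0: "linear_on S f \<Longrightarrow> v \<in> S \<Longrightarrow> f 0 = 0"
  unfolding linear_on_def by (metis scaleR_zero_left)

lemma linear_on_minus: "linear_on S f \<Longrightarrow> v \<in> S \<Longrightarrow> f (- v) = - f v"
  unfolding linear_on_def by (metis scaleR_minus1_left)

context smooth_manifold
begin

lemma manifold: "smooth_manifold A" by unfold_locales

lemmas smooth_add = smooth_fun_add[OF manifold]
lemmas smooth_mult = smooth_fun_mult[OF manifold]
lemmas smooth_const = smooth_fun_const[OF manifold]

lemma smooth_0: "smooth_fun A 0"
  using smooth_const[of 0] by (simp add: zero_fun_def)

lemma smooth_minus: "smooth_fun A f \<Longrightarrow> smooth_fun A (- f)"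
  using smooth_mult[OF smooth_const[of "- 1"]] by (simp add: times_fun_def fun_Compl_def)

lemma smooth_diff: "smooth_fun A f \<Longrightarrow> smooth_fun A f' \<Longrightarrow> smooth_fun A (f - f')"
  using smooth_add[OF _ smooth_minus] by fastforce

lemmas smooth_intros = smooth_add smooth_mult smooth_const smooth_0 smooth_minus smooth_diff

lemma vector_field_in_tangent_space: "vector_field A X \<Longrightarrow> X p \<in> tangent_space A p"
  and smooth_dir_deriv: "vector_field A X \<Longrightarrow> smooth_fun A f \<Longrightarrow> smooth_fun A (dir_deriv X f)"
  by (auto simp: vector_field_def)

lemma dir_deriv_field_simps:
  "dir_deriv (X + Y) f = dir_deriv X f + dir_deriv Y f"
  "dir_deriv (X - Y) f = dir_deriv X f - dir_deriv Y f"
  "dir_deriv (- X) f = - dir_deriv X f"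
  "dir_deriv (a \<odot> X) f = a * dir_deriv X f"
  "dir_deriv 0 f = 0"
  by (simp_all add: fun_eq_iff dir_deriv_def fscale_def)

lemma vector_field_add: "vector_field A X \<Longrightarrow> vector_field A Y \<Longrightarrow> vector_field A (X + Y)"
  using subspace_add[OF tangent_space_subspace[OF manifold]]
  unfolding vector_field_def dir_deriv_field_simps by (auto intro: smooth_add)

lemma vector_field_fscale: "smooth_fun A a \<Longrightarrow> vector_field A X \<Longrightarrow> vector_field A (a \<odot> X)"
  using subspace_scale[OF tangent_space_subspace[OF manifold]]
  unfolding vector_field_def dir_deriv_field_simps by (auto simp: fscale_def intro: smooth_mult)

lemma vector_field_0: "vector_field A 0"
  using subspace_0[OF tangent_space_subspace[OF manifold]] smooth_0
  by (simp add: vector_field_def dir_deriv_def zero_fun_def)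

lemma vector_field_minus: "vector_field A X \<Longrightarrow> vector_field A (- X)"
  using vector_field_fscale[OF smooth_minus[OF smooth_const[of 1]], of X]
  by (simp add: one_fun_def[symmetric] fscale_simps)

lemma vector_field_diff: "vector_field A X \<Longrightarrow> vector_field A Y \<Longrightarrow> vector_field A (X - Y)"
  using vector_field_add[OF _ vector_field_minus] by fastforce

lemmas vector_field_intros =
  vector_field_add vector_field_fscale vector_field_0 vector_field_minus vector_field_diff

lemma dir_deriv_mult:
  "vector_field A X \<Longrightarrow> smooth_fun A f \<Longrightarrow> smooth_fun A f' \<Longrightarrow>
    dir_deriv X (f * f') = f * dir_deriv X f' + f' * dir_deriv X f"
  using vector_field_in_tangent_space[of X]
  by (simp add: tangent_space_def dir_deriv_def fun_eq_iff)

lemma dir_deriv_add: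
  "vector_field A X \<Longrightarrow> smooth_fun A f \<Longrightarrow> smooth_fun A f' \<Longrightarrow>
    dir_deriv X (f + f') = dir_deriv X f + dir_deriv X f'"
  using vector_field_in_tangent_space[of X]
  by (simp add: tangent_space_def linear_on_def dir_deriv_def fun_eq_iff)

lemma dir_deriv_minus:
  assumes "vector_field A X" "smooth_fun A f"
  shows "dir_deriv X (- f) = - dir_deriv X f"
proof
  fix p
  have "linear_on (Collect (smooth_fun A)) (X p)"
    using vector_field_in_tangent_space[OF assms(1)] by (simp add: tangent_space_def)
  from linear_on_minus[OF this] show "dir_deriv X (- f) p = (- dir_deriv X f) p"
    using assms(2) by (simp add: dir_deriv_def)
qed

lemma dir_deriv_diff:
  "vector_field A X \<Longrightarrow> smooth_fun A f \<Longrightarrow> smooth_fun A f' \<Longrightarrow>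
    dir_deriv X (f - f') = dir_deriv X f - dir_deriv X f'"
  using dir_deriv_add[of X f "- f'"] smooth_minus dir_deriv_minus by simp

lemma dir_deriv_const:
  assumes "vector_field A X"
  shows "dir_deriv X (\<lambda>_. c) = 0"
proof -
  have 1: "dir_deriv X (1 * 1) = 1 * dir_deriv X 1 + 1 * dir_deriv X 1"
    using smooth_const[of 1] by (intro dir_deriv_mult assms) (simp_all add: one_fun_def)
  then have 1: "dir_deriv X 1 = 0" by simp
  have "(\<lambda>_. c) = c *\<^sub>R (1 :: 'a \<Rightarrow> real)" by (simp add: fun_eq_iff)
  moreover have "dir_deriv X (c *\<^sub>R 1) = c *\<^sub>R dir_deriv X 1"
    using vector_field_in_tangent_space[OF assms] smooth_const[of 1]
    by (simp add: tangent_space_def linear_on_def dir_deriv_def fun_eq_iff one_fun_def)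
  ultimately show ?thesis using 1 by (metis scaleR_zero_right)
qed

lemma dir_deriv_0: "vector_field A X \<Longrightarrow> dir_deriv X 0 = 0"
  using dir_deriv_const[of X 0] by (simp add: zero_fun_def)

lemma dir_deriv_1: "vector_field A X \<Longrightarrow> dir_deriv X 1 = 0"
  using dir_deriv_const[of X 1] by (simp add: one_fun_def)

lemma dir_deriv_lie_bracket:
  "dir_deriv (lie_bracket X Y) f = dir_deriv X (dir_deriv Y f) - dir_deriv Y (dir_deriv X f)"
  by (simp add: fun_eq_iff dir_deriv_def lie_bracket_def)

text \<open>
  Testing on smooth functions suffices because tangent vectors vanish on all other functions.
\<close>

lemma vector_field_eqI:
  assumes "vector_field A X" "vector_field A Y"
    and "\<And>f. smooth_fun A f \<Longrightarrow> dir_deriv X f = dir_deriv Y f"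
  shows "X = Y"
proof (intro HOL.ext)
  fix p f
  show "X p f = Y p f"
  proof (cases "smooth_fun A f")
    case True
    from fun_cong[OF assms(3)[OF this], of p] show ?thesis by (simp add: dir_deriv_def)
  next
    case False
    then show ?thesis
      using vector_field_in_tangent_space[OF assms(1), of p] vector_field_in_tangent_space[OF assms(2), of p]
      by (simp add: tangent_space_def)
  qed
qed

end

section \<open>The Levi-Civita connection and the symmetries of its curvature\<close>

context riemannian_manifold
begin

abbreviation ip :: "'m vfield \<Rightarrow> 'm vfield \<Rightarrow> 'm \<Rightarrow> real" where "ip \<equiv> ev2 g"

lemma metric_zero_left: "u \<in> tangent_space A p \<Longrightarrow> g p 0 u = 0"
  using metric_sym[OF subspace_0[OF tangent_space_subspace[OF manifold]]]
    linear_on_0[OF metric_linear] by metis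

lemma metric_add_left:
  assumes "u \<in> tangent_space A p" "v \<in> tangent_space A p" "w \<in> tangent_space A p"
  shows "g p (u + v) w = g p u w + g p v w"
  using assms metric_linear[OF assms(3)] metric_sym[OF assms(3)]
    subspace_add[OF tangent_space_subspace[OF manifold]]
  unfolding linear_on_def by metis

lemma metric_scale_left:
  assumes "u \<in> tangent_space A p" "w \<in> tangent_space A p"
  shows "g p (c *\<^sub>R u) w = c * g p u w"
  using assms metric_linear[OF assms(2)] metric_sym[OF assms(2)]
    subspace_scale[OF tangent_space_subspace[OF manifold]]
  unfolding linear_on_def by (metis real_scaleR_def)

lemma metric_zero_iff: "u \<in> tangent_space A p \<Longrightarrow> g p u u = 0 \<longleftrightarrow> u = 0"
  using metric_pos metric_zero_left by fastforce

lemma ip_commute: "vector_field A X \<Longrightarrow> vector_field A Y \<Longrightarrow> ip X Y = ip Y X"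
  using metric_sym vector_field_in_tangent_space by (simp add: ev2_def fun_eq_iff)

lemma ip_add_left:
  "vector_field A X \<Longrightarrow> vector_field A Y \<Longrightarrow> vector_field A Z \<Longrightarrow> ip (X + Y) Z = ip X Z + ip Y Z"
  using metric_add_left vector_field_in_tangent_space by (simp add: ev2_def fun_eq_iff)

lemma ip_fscale_left:
  "vector_field A X \<Longrightarrow> vector_field A Y \<Longrightarrow> ip (a \<odot> X) Y = a * ip X Y"
  using metric_scale_left vector_field_in_tangent_space by (simp add: ev2_def fun_eq_iff fscale_def)

lemma ip_zero_left: "vector_field A X \<Longrightarrow> ip 0 X = 0"
  using metric_zero_left vector_field_in_tangent_space by (simp add: ev2_def fun_eq_iff)

lemma ip_minus_left: "vector_field A X \<Longrightarrow> vector_field A Y \<Longrightarrow> ip (- X) Y = - ip X Y"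
  using ip_fscale_left[of X Y "- 1"] by (simp add: fscale_simps)

lemma ip_diff_left:
  "vector_field A X \<Longrightarrow> vector_field A Y \<Longrightarrow> vector_field A Z \<Longrightarrow> ip (X - Y) Z = ip X Z - ip Y Z"
  using ip_add_left[of X "- Y" Z] by (simp add: ip_minus_left vector_field_intros)

lemma ip_add_right:
  "vector_field A X \<Longrightarrow> vector_field A Y \<Longrightarrow> vector_field A Z \<Longrightarrow> ip Z (X + Y) = ip Z X + ip Z Y"
  by (simp add: ip_commute[of Z] ip_add_left vector_field_intros)

lemma ip_fscale_right:
  "vector_field A X \<Longrightarrow> vector_field A Y \<Longrightarrow> ip Y (a \<odot> X) = a * ip Y X"
  using metric_linear vector_field_in_tangent_space
  by (simp add: ev2_def fun_eq_iff fscale_def linear_on_def)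

lemma ip_zero_right: "vector_field A X \<Longrightarrow> ip X 0 = 0"
  by (simp add: ip_commute[of X] ip_zero_left vector_field_intros)

lemma ip_minus_right: "vector_field A X \<Longrightarrow> vector_field A Y \<Longrightarrow> ip Y (- X) = - ip Y X"
  by (simp add: ip_commute[of Y] ip_minus_left vector_field_intros)

lemma ip_diff_right:
  "vector_field A X \<Longrightarrow> vector_field A Y \<Longrightarrow> vector_field A Z \<Longrightarrow> ip Z (X - Y) = ip Z X - ip Z Y"
  by (simp add: ip_commute[of Z] ip_diff_left vector_field_intros)

lemmas ip_simps = ip_add_left ip_fscale_left ip_zero_left ip_minus_left ip_diff_left
  ip_add_right ip_fscale_right ip_zero_right ip_minus_right ip_diff_right

lemma ip_self_eq_0: "vector_field A X \<Longrightarrow> ip X X = 0 \<Longrightarrow> X = 0"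
  using metric_zero_iff vector_field_in_tangent_space by (simp add: ev2_def fun_eq_iff[of X] fun_eq_iff[of "\<lambda>p. g p (X p) (X p)"])

lemma vector_field_eq_by_ip:
  assumes "vector_field A X" "vector_field A Y"
    and "\<And>Z. vector_field A Z \<Longrightarrow> ip X Z = ip Y Z"
  shows "X = Y"
proof -
  have "ip (X - Y) (X - Y) = 0"
    using assms by (simp add: ip_diff_left vector_field_intros)
  then have "X - Y = 0" using ip_self_eq_0 assms vector_field_diff by blast
  then show ?thesis by simp
qed

end

locale riemannian_levi_civita = riemannian_manifold A g
  for A :: "('m::{t2_space, second_countable_topology}, 'e::euclidean_space) chart set"
    and g :: "'m \<Rightarrow> 'm tvec \<Rightarrow> 'm tvec \<Rightarrow> real" +
  fixes nabla :: "'m vfield \<Rightarrow> 'm vfield \<Rightarrow> 'm vfield"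
  assumes levi_civita: "levi_civita A g nabla"
begin

lemma nabla_affine: "affine_connection A nabla"
  using levi_civita by (simp add: levi_civita_def)

lemma vector_field_nabla:
    "vector_field A X \<Longrightarrow> vector_field A Y \<Longrightarrow> vector_field A (nabla X Y)"
  and nabla_add_left: "vector_field A X \<Longrightarrow> vector_field A X' \<Longrightarrow> vector_field A Y \<Longrightarrow>
    nabla (X + X') Y = nabla X Y + nabla X' Y"
  and nabla_fscale_left: "smooth_fun A f \<Longrightarrow> vector_field A X \<Longrightarrow> vector_field A Y \<Longrightarrow>
    nabla (f \<odot> X) Y = f \<odot> nabla X Y"
  and nabla_add_right: "vector_field A X \<Longrightarrow> vector_field A Y \<Longrightarrow> vector_field A Y' \<Longrightarrow>
    nabla X (Y + Y') = nabla X Y + nabla X Y'"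
  and nabla_fscale_right: "smooth_fun A f \<Longrightarrow> vector_field A X \<Longrightarrow> vector_field A Y \<Longrightarrow>
    nabla X (f \<odot> Y) = dir_deriv X f \<odot> Y + f \<odot> nabla X Y"
  using nabla_affine unfolding affine_connection_def by blast+

lemma nabla_minus_left: "vector_field A X \<Longrightarrow> vector_field A Y \<Longrightarrow> nabla (- X) Y = - nabla X Y"
  using nabla_fscale_left[OF smooth_const[of "- 1"], of X Y]
  by (simp add: fscale_def fun_eq_iff fun_Compl_def)

lemma nabla_minus_right: "vector_field A X \<Longrightarrow> vector_field A Y \<Longrightarrow> nabla X (- Y) = - nabla X Y"
  using nabla_fscale_right[OF smooth_const[of "- 1"], of X Y]
  by (simp add: fscale_def fun_eq_iff fun_Compl_def dir_deriv_const)

lemma nabla_diff_left: "vector_field A X \<Longrightarrow> vector_field A X' \<Longrightarrow> vector_field A Y \<Longrightarrow>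
    nabla (X - X') Y = nabla X Y - nabla X' Y"
  using nabla_add_left[of X "- X'" Y] by (simp add: nabla_minus_left vector_field_intros)

lemma nabla_diff_right: "vector_field A X \<Longrightarrow> vector_field A Y \<Longrightarrow> vector_field A Y' \<Longrightarrow>
    nabla X (Y - Y') = nabla X Y - nabla X Y'"
  using nabla_add_right[of X Y "- Y'"] by (simp add: nabla_minus_right vector_field_intros)

lemma nabla_zero_right: "vector_field A X \<Longrightarrow> nabla X 0 = 0"
  using nabla_diff_right[of X 0 0] by (simp add: vector_field_0)

lemma nabla_zero_left: "vector_field A X \<Longrightarrow> nabla 0 X = 0"
  using nabla_diff_left[of 0 0 X] by (simp add: vector_field_0)

lemmas nabla_simps = nabla_add_left nabla_fscale_left nabla_add_right nabla_fscale_right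
  nabla_minus_left nabla_minus_right nabla_diff_left nabla_diff_right nabla_zero_left nabla_zero_right

lemma lie_bracket_eq:
  "vector_field A X \<Longrightarrow> vector_field A Y \<Longrightarrow> lie_bracket X Y = nabla X Y - nabla Y X"
  using levi_civita by (simp add: levi_civita_def)

lemma nabla_metric:
  "vector_field A X \<Longrightarrow> vector_field A Y \<Longrightarrow> vector_field A Z \<Longrightarrow>
    dir_deriv X (ip Y Z) = ip (nabla X Y) Z + ip Y (nabla X Z)"
  using levi_civita by (simp add: levi_civita_def)

lemma vector_field_lie_bracket:
  "vector_field A X \<Longrightarrow> vector_field A Y \<Longrightarrow> vector_field A (lie_bracket X Y)"
  by (simp add: lie_bracket_eq vector_field_nabla vector_field_diff)

lemmas fields = vector_field_intros vector_field_nabla vector_field_lie_bracket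
  metric_smooth smooth_dir_deriv smooth_intros

lemma vector_field_curvature:
  "vector_field A X \<Longrightarrow> vector_field A Y \<Longrightarrow> vector_field A Z \<Longrightarrow>
    vector_field A (curvature nabla X Y Z)"
  by (simp add: curvature_def fields)

text \<open>
  The commutator of derivations \<open>X\<close>, \<open>Y\<close> and the derivation \<open>[X,Y]\<close> agree on the function \<open>g(Z,W)\<close>; expanding
  both by the product rule gives the skew symmetry. Stated for a subset \<open>H\<close> of the vector fields, it
  applies to the Levi-Civita connection of the manifold as well as to that of the leaves of a
  foliation.
\<close>

lemma metric_derivation_curvature_skew:
  assumes X: "vector_field A X" and Y: "vector_field A Y"
    and H: "\<And>Z. Z \<in> H \<Longrightarrow> vector_field A Z"
    and closed: "\<And>Z. Z \<in> H \<Longrightarrow> DX Z \<in> H \<and> DY Z \<in> H \<and> DXY Z \<in> H"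
    and DX: "\<And>Z W. Z \<in> H \<Longrightarrow> W \<in> H \<Longrightarrow> dir_deriv X (ip Z W) = ip (DX Z) W + ip Z (DX W)"
    and DY: "\<And>Z W. Z \<in> H \<Longrightarrow> W \<in> H \<Longrightarrow> dir_deriv Y (ip Z W) = ip (DY Z) W + ip Z (DY W)"
    and DXY: "\<And>Z W. Z \<in> H \<Longrightarrow> W \<in> H \<Longrightarrow>
      dir_deriv (lie_bracket X Y) (ip Z W) = ip (DXY Z) W + ip Z (DXY W)"
    and Z: "Z \<in> H" and W: "W \<in> H"
  shows "ip (DX (DY Z) - DY (DX Z) - DXY Z) W = - ip Z (DX (DY W) - DY (DX W) - DXY W)"
proof -
  note [simp] = H Z W fields
  have [simp]: "DX Z \<in> H" "DY Z \<in> H" "DXY Z \<in> H" if "Z \<in> H" for Z using closed[OF that] by auto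
  have "dir_deriv (lie_bracket X Y) (ip Z W) =
      dir_deriv X (dir_deriv Y (ip Z W)) - dir_deriv Y (dir_deriv X (ip Z W))"
    by (rule dir_deriv_lie_bracket)
  then show ?thesis
    by (simp add: DX DY DXY X Y dir_deriv_add ip_simps algebra_simps)
qed

lemma curvature_skew:
  assumes "vector_field A X" "vector_field A Y" "vector_field A Z" "vector_field A W"
  shows "ip (curvature nabla X Y Z) W = - ip Z (curvature nabla X Y W)"
  unfolding curvature_def
  by (rule metric_derivation_curvature_skew[where H = "Collect (vector_field A)" and X = X and Y = Y])
    (use assms in \<open>simp_all add: fields nabla_metric\<close>)

lemma curvature_antisym: "vector_field A X \<Longrightarrow> vector_field A Y \<Longrightarrow> vector_field A Z \<Longrightarrow>
    curvature nabla X Y Z = - curvature nabla Y X Z"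
  by (simp add: curvature_def lie_bracket_eq nabla_simps fields)

lemma jacobi_identity:
  assumes "vector_field A X" "vector_field A Y" "vector_field A Z"
  shows "lie_bracket (lie_bracket X Y) Z + lie_bracket (lie_bracket Y Z) X
    + lie_bracket (lie_bracket Z X) Y = 0"
  by (rule vector_field_eqI)
    (use assms in \<open>simp_all add: fields dir_deriv_field_simps dir_deriv_lie_bracket dir_deriv_diff\<close>)

text \<open>
  As the connection is torsion free, the cyclic sum is the negative of the Jacobi identity.
\<close>

lemma bianchi:
  assumes "vector_field A X" "vector_field A Y" "vector_field A Z"
  shows "curvature nabla X Y Z + curvature nabla Y Z X + curvature nabla Z X Y = 0"
proof -
  note [simp] = assms fields
  have "- (lie_bracket (lie_bracket X Y) Z + lie_bracket (lie_bracket Y Z) X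
      + lie_bracket (lie_bracket Z X) Y) = curvature nabla X Y Z + curvature nabla Y Z X + curvature nabla Z X Y"
    by (simp add: curvature_def lie_bracket_eq nabla_simps)
  then show ?thesis by (simp add: jacobi_identity)
qed

text \<open>
  The classical octahedron argument: add up four instances of the Bianchi identity and cancel with
  the two skew symmetries.
\<close>

lemma curvature_pair_symmetry:
  assumes "vector_field A X" "vector_field A Y" "vector_field A Z" "vector_field A W"
  shows "ip (curvature nabla X Y Z) W = ip (curvature nabla Z W X) Y"
proof -
  define r where "r X Y Z W = ip (curvature nabla X Y Z) W" for X Y Z W
  have skew: "r X Y Z W = - r X Y W Z" and anti: "r X Y Z W = - r Y X Z W"
    and cyc: "r X Y Z W + r Y Z X W + r Z X Y W = 0"
    if "vector_field A X" "vector_field A Y" "vector_field A Z" "vector_field A W" for X Y Z W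
  proof -
    note [simp] = that vector_field_curvature fields
    show "r X Y Z W = - r X Y W Z"
      using curvature_skew[OF that] by (simp add: r_def ip_commute)
    show "r X Y Z W = - r Y X Z W"
      using curvature_antisym[OF that(1-3)] by (simp add: r_def ip_simps)
    have "ip (curvature nabla X Y Z + curvature nabla Y Z X + curvature nabla Z X Y) W = 0"
      by (simp only: bianchi[OF that(1-3)] ip_zero_left[OF that(4)])
    then show "r X Y Z W + r Y Z X W + r Z X Y W = 0"
      by (simp add: r_def ip_simps)
  qed
  have "r X Y Z W p = r Z W X Y p" for p
  proof -
    note a = assms
    have "(r X Y Z W + r Y Z X W + r Z X Y W) p = 0" "(r Y Z W X + r Z W Y X + r W Y Z X) p = 0"
      "(r Z W X Y + r W X Z Y + r X Z W Y) p = 0" "(r W X Y Z + r X Y W Z + r Y W X Z) p = 0"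
      by (simp_all only: cyc a zero_fun_apply)
    moreover have
      "r X Y W Z p = - r X Y Z W p" "r Y Z W X p = - r Y Z X W p" "r Z X Y W p = - r X Z Y W p"
      "r X Z W Y p = - r X Z Y W p" "r Z W Y X p = - r Z W X Y p" "r W Y Z X p = - r Y W Z X p"
      "r Y W X Z p = - r Y W Z X p" "r W X Z Y p = - r W X Y Z p"
      using skew[OF a(1,2,4,3)] skew[OF a(2,3,4,1)] anti[OF a(3,1,2,4)] skew[OF a(1,3,4,2)]
        skew[OF a(3,4,2,1)] anti[OF a(4,2,3,1)] skew[OF a(2,4,1,3)] skew[OF a(4,1,3,2)]
      by simp_all
    ultimately show ?thesis by simp
  qed
  then show ?thesis by (auto simp: r_def fun_eq_iff)
qed

lemma curvature_add_left:
  assumes "vector_field A X" "vector_field A X'" "vector_field A Y" "vector_field A Z"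
  shows "curvature nabla (X + X') Y Z = curvature nabla X Y Z + curvature nabla X' Y Z"
  using assms by (simp add: curvature_def lie_bracket_eq nabla_simps fields)

lemma curvature_fscale_left:
  assumes "smooth_fun A f" "vector_field A X" "vector_field A Y" "vector_field A Z"
  shows "curvature nabla (f \<odot> X) Y Z = f \<odot> curvature nabla X Y Z"
  using assms by (simp add: curvature_def lie_bracket_eq nabla_simps fields fscale_simps)

lemma curvature_add_mid:
  assumes "vector_field A X" "vector_field A Y" "vector_field A Y'" "vector_field A Z"
  shows "curvature nabla X (Y + Y') Z = curvature nabla X Y Z + curvature nabla X Y' Z"
  using assms by (simp add: curvature_def lie_bracket_eq nabla_simps fields)

lemma curvature_fscale_mid:
  assumes "smooth_fun A f" "vector_field A X" "vector_field A Y" "vector_field A Z"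
  shows "curvature nabla X (f \<odot> Y) Z = f \<odot> curvature nabla X Y Z"
  using assms curvature_antisym[of X] by (simp add: curvature_fscale_left fields fscale_simps)

lemma curvature_add_right:
  assumes "vector_field A X" "vector_field A Y" "vector_field A Z" "vector_field A Z'"
  shows "curvature nabla X Y (Z + Z') = curvature nabla X Y Z + curvature nabla X Y Z'"
  using assms by (simp add: curvature_def nabla_simps fields)

text \<open>
  By pair symmetry, homogeneity in the last argument is homogeneity in the first.
\<close>

lemma curvature_fscale_right:
  assumes "smooth_fun A f" "vector_field A X" "vector_field A Y" "vector_field A Z"
  shows "curvature nabla X Y (f \<odot> Z) = f \<odot> curvature nabla X Y Z"
  by (rule vector_field_eq_by_ip)
    (use assms in \<open>simp_all add: curvature_pair_symmetry[of X Y] curvature_fscale_left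
      vector_field_curvature fields ip_simps\<close>)

end

section \<open>Almost contact metric structures\<close>

lemma linear_on_diff:
  assumes "linear_on S f" "u \<in> S" "v \<in> S" "- v \<in> S"
  shows "f (u - v) = f u - f v"
proof -
  have "f (u + - v) = f u + f (- v)" using assms unfolding linear_on_def by blast
  then show ?thesis using linear_on_minus[OF assms(1,3)] by simp
qed

context riemannian_manifold
begin

lemma metric_diff_right:
  "u \<in> tangent_space A p \<Longrightarrow> v \<in> tangent_space A p \<Longrightarrow> w \<in> tangent_space A p \<Longrightarrow>
    g p u (v - w) = g p u v - g p u w"
  by (rule linear_on_diff[OF metric_linear]) (simp_all add: subspace_neg[OF tangent_space_subspace[OF manifold]])

lemma metric_diff_left:
  "u \<in> tangent_space A p \<Longrightarrow> v \<in> tangent_space A p \<Longrightarrow> w \<in> tangent_space A p \<Longrightarrow>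
    g p (u - v) w = g p u w - g p v w"
  using metric_diff_right[of w p u v] metric_sym[of w p]
    subspace_diff[OF tangent_space_subspace[OF manifold]] by simp

lemma metric_scale_right:
  "u \<in> tangent_space A p \<Longrightarrow> v \<in> tangent_space A p \<Longrightarrow> g p u (c *\<^sub>R v) = c * g p u v"
  using metric_linear unfolding linear_on_def by auto

lemma metric_sum_left:
  assumes "finite B" "\<And>v. v \<in> B \<Longrightarrow> v \<in> tangent_space A p" "w \<in> tangent_space A p"
  shows "g p (\<Sum>v\<in>B. c v *\<^sub>R v) w = (\<Sum>v\<in>B. c v * g p v w)"
  using assms(1,2)
proof (induction B rule: finite_induct)
  case empty
  then show ?case by (simp only: sum.empty metric_zero_left[OF assms(3)])
next
  case (insert u B)
  have "(\<Sum>v\<in>B. c v *\<^sub>R v) \<in> tangent_space A p"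
    using insert.prems by (intro subspace_sum subspace_scale tangent_space_subspace manifold) auto
  moreover have "c u *\<^sub>R u \<in> tangent_space A p"
    using insert.prems by (intro subspace_scale tangent_space_subspace manifold) auto
  ultimately show ?case
    using insert.prems insert.IH[OF insert.prems[OF insertI2]] assms(3)
    by (simp only: sum.insert[OF insert.hyps] metric_add_left metric_scale_left insertCI)
qed

lemma orthogonal_independent:
  assumes B: "finite B" "B \<subseteq> tangent_space A p" "0 \<notin> B"
    and orth: "\<And>u v. u \<in> B \<Longrightarrow> v \<in> B \<Longrightarrow> u \<noteq> v \<Longrightarrow> g p u v = 0"
  shows "independent B"
proof
  assume "dependent B"
  then obtain c u where u: "u \<in> B" "c u \<noteq> 0" and 0: "(\<Sum>v\<in>B. c v *\<^sub>R v) = 0"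
    using dependent_finite[OF B(1)] by blast
  have "0 = g p (\<Sum>v\<in>B. c v *\<^sub>R v) u"
    using u B by (simp add: 0 metric_zero_left subsetD)
  also have "\<dots> = (\<Sum>v\<in>B. c v * g p v u)"
    using u B by (intro metric_sum_left) auto
  also have "\<dots> = (\<Sum>v\<in>B. if v = u then c u * g p u u else 0)"
    using orth u by (intro sum.cong) auto
  also have "\<dots> = c u * g p u u" using u B by simp
  finally show False using u B metric_zero_iff[of u p] by (metis mult_eq_0_iff subsetD)
qed

end

context almost_contact_metric_manifold
begin

abbreviation phi_field :: "'m vfield \<Rightarrow> 'm vfield" where "phi_field \<equiv> ev1 \<phi>"
abbreviation eta_field :: "'m vfield \<Rightarrow> 'm \<Rightarrow> real" where "eta_field \<equiv> ev1 \<eta>"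

lemmas ts_add = subspace_add[OF tangent_space_subspace[OF manifold]]
  and ts_scale = subspace_scale[OF tangent_space_subspace[OF manifold]]
  and ts_0 = subspace_0[OF tangent_space_subspace[OF manifold]]
  and ts_minus = subspace_neg[OF tangent_space_subspace[OF manifold]]
  and ts_diff = subspace_diff[OF tangent_space_subspace[OF manifold]]

lemma phi_tangent: "u \<in> tangent_space A p \<Longrightarrow> \<phi> p u \<in> tangent_space A p"
  and phi_linear: "linear_on (tangent_space A p) (\<phi> p)"
  and vector_field_phi: "vector_field A X \<Longrightarrow> vector_field A (phi_field X)"
  using phi_tensor unfolding tensor11_def by blast+

lemma eta_linear: "linear_on (tangent_space A p) (\<eta> p)"
  and smooth_eta: "vector_field A X \<Longrightarrow> smooth_fun A (eta_field X)"
  using eta_form unfolding one_form_def by blast+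

lemma xi_tangent: "\<xi> p \<in> tangent_space A p"
  using xi_field by (rule vector_field_in_tangent_space)

lemmas ts_intros = ts_add ts_scale ts_0 ts_minus ts_diff phi_tangent xi_tangent

lemma phi_add: "u \<in> tangent_space A p \<Longrightarrow> v \<in> tangent_space A p \<Longrightarrow> \<phi> p (u + v) = \<phi> p u + \<phi> p v"
  and phi_scale: "u \<in> tangent_space A p \<Longrightarrow> \<phi> p (a *\<^sub>R u) = a *\<^sub>R \<phi> p u"
  using phi_linear unfolding linear_on_def by blast+

lemma phi_diff:
    "u \<in> tangent_space A p \<Longrightarrow> v \<in> tangent_space A p \<Longrightarrow> \<phi> p (u - v) = \<phi> p u - \<phi> p v"
  by (rule linear_on_diff[OF phi_linear]) (simp_all add: ts_minus)

lemma phi_0: "\<phi> p 0 = 0" and phi_minus: "u \<in> tangent_space A p \<Longrightarrow> \<phi> p (- u) = - \<phi> p u"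
  using linear_on_0[OF phi_linear xi_tangent] linear_on_minus[OF phi_linear] by blast+

lemma eta_scale: "u \<in> tangent_space A p \<Longrightarrow> \<eta> p (a *\<^sub>R u) = a * \<eta> p u"
  using eta_linear unfolding linear_on_def by auto

lemma eta_diff:
    "u \<in> tangent_space A p \<Longrightarrow> v \<in> tangent_space A p \<Longrightarrow> \<eta> p (u - v) = \<eta> p u - \<eta> p v"
  by (rule linear_on_diff[OF eta_linear]) (simp_all add: ts_minus)

lemma eta_0: "\<eta> p 0 = 0"
  using linear_on_0[OF eta_linear xi_tangent] .

text \<open>
  Since \<open>\<phi>\<^sup>2\<xi> = 0\<close>, applying \<open>\<phi>\<^sup>2\<close> to \<open>\<phi>\<xi>\<close> shows that \<open>\<phi>\<xi> = a\<xi>\<close> for some number \<open>a\<close>; then \<open>0 = \<phi>\<^sup>2\<xi> = a \<phi>\<xi>\<close>.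
\<close>

lemma phi_xi: "\<phi> p (\<xi> p) = 0"
proof -
  let ?a = "\<eta> p (\<phi> p (\<xi> p))"
  have 0: "\<phi> p (\<phi> p (\<xi> p)) = 0" using phi_phi[OF xi_tangent] by (simp add: eta_xi)
  have "- \<phi> p (\<xi> p) + ?a *\<^sub>R \<xi> p = 0"
    using phi_phi[OF phi_tangent[OF xi_tangent[of p]]] by (simp only: 0 phi_0)
  then have 1: "\<phi> p (\<xi> p) = ?a *\<^sub>R \<xi> p" by (simp add: add_eq_0_iff2)
  then have "\<phi> p (\<phi> p (\<xi> p)) = ?a *\<^sub>R \<phi> p (\<xi> p)"
    using phi_scale[OF xi_tangent] by metis
  then have "?a = 0 \<or> \<phi> p (\<xi> p) = 0" using 0 by simp
  then show ?thesis using 1 by auto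
qed

text \<open>
  Evaluate \<open>\<phi>\<^sup>3\<close> as \<open>\<phi>\<^sup>2 \<circ> \<phi>\<close> and as \<open>\<phi> \<circ> \<phi>\<^sup>2\<close>.
\<close>

lemma eta_phi:
  assumes "u \<in> tangent_space A p"
  shows "\<eta> p (\<phi> p u) = 0"
proof -
  have "\<phi> p (\<phi> p (\<phi> p u)) = - \<phi> p u + \<eta> p (\<phi> p u) *\<^sub>R \<xi> p"
    by (rule phi_phi[OF phi_tangent[OF assms]])
  moreover have "\<phi> p (\<phi> p (\<phi> p u)) = \<phi> p (- u + \<eta> p u *\<^sub>R \<xi> p)"
    by (simp only: phi_phi[OF assms])
  then have "\<phi> p (\<phi> p (\<phi> p u)) = - \<phi> p u"
    using assms by (simp add: phi_diff phi_scale ts_intros phi_xi)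
  ultimately have "\<eta> p (\<phi> p u) *\<^sub>R \<xi> p = 0" by simp
  moreover have "\<xi> p \<noteq> 0" using eta_xi[of p] eta_0 by force
  ultimately show ?thesis by simp
qed

lemma metric_xi:
  assumes "u \<in> tangent_space A p"
  shows "g p u (\<xi> p) = \<eta> p u"
proof -
  have "g p (\<phi> p u) 0 = 0"
    using metric_zero_left[OF phi_tangent[OF assms]] metric_sym[OF phi_tangent[OF assms] ts_0] by simp
  then show ?thesis using metric_phi[OF assms xi_tangent] by (simp add: phi_xi eta_xi)
qed

lemma metric_phi_skew:
  assumes u: "u \<in> tangent_space A p" and v: "v \<in> tangent_space A p"
  shows "g p (\<phi> p u) v = - g p u (\<phi> p v)"
proof -
  have "g p (\<phi> p u) (\<phi> p (\<phi> p v)) = g p u (\<phi> p v)"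
    using metric_phi[OF u phi_tangent[OF v]] by (simp add: eta_phi[OF v])
  moreover have "g p (\<phi> p u) (- v + \<eta> p v *\<^sub>R \<xi> p) = - g p (\<phi> p u) v"
    using u v by (simp add: metric_diff_right metric_scale_right ts_intros metric_xi eta_phi)
  ultimately show ?thesis by (simp add: phi_phi[OF v])
qed

lemma phi_field_add: "vector_field A X \<Longrightarrow> vector_field A Y \<Longrightarrow> phi_field (X + Y) = phi_field X + phi_field Y"
  and phi_field_fscale: "vector_field A X \<Longrightarrow> phi_field (a \<odot> X) = a \<odot> phi_field X"
  and phi_field_minus: "vector_field A X \<Longrightarrow> phi_field (- X) = - phi_field X"
  and phi_field_0: "phi_field 0 = 0"
  and phi_field_xi: "phi_field \<xi> = 0"
  by (rule HOL.ext, simp add: ev1_def fscale_def phi_add phi_scale phi_minus phi_0 phi_xi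
      vector_field_in_tangent_space)+

lemma phi_field_diff:
  "vector_field A X \<Longrightarrow> vector_field A Y \<Longrightarrow> phi_field (X - Y) = phi_field X - phi_field Y"
  using phi_field_add[of X "- Y"] by (simp add: phi_field_minus vector_field_minus)

lemma phi_field_phi:
  "vector_field A X \<Longrightarrow> phi_field (phi_field X) = - X + eta_field X \<odot> \<xi>"
  by (rule HOL.ext) (simp add: ev1_def fscale_def phi_phi vector_field_in_tangent_space)

lemmas phi_simps = phi_field_add phi_field_fscale phi_field_minus phi_field_0 phi_field_xi
  phi_field_diff

lemma eta_field_eq: "vector_field A X \<Longrightarrow> eta_field X = ev2 g X \<xi>"
  by (simp add: ev1_def ev2_def metric_xi vector_field_in_tangent_space)

lemma eta_field_xi: "eta_field \<xi> = 1"
  by (simp add: ev1_def eta_xi one_fun_def)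

lemma ip_phi_left: "vector_field A X \<Longrightarrow> vector_field A Y \<Longrightarrow> ip (phi_field X) Y = - ip X (phi_field Y)"
  by (simp add: ev1_def ev2_def fun_eq_iff metric_phi_skew vector_field_in_tangent_space)

definition horizontal :: "'m vfield \<Rightarrow> bool" where
  "horizontal X \<longleftrightarrow> vector_field A X \<and> eta_field X = 0"

lemma hor_vf: "horizontal X \<Longrightarrow> vector_field A X"
  and hor_eta: "horizontal X \<Longrightarrow> eta_field X = 0"
  by (simp_all add: horizontal_def)

lemma hor_ip_xi: "horizontal X \<Longrightarrow> ip X \<xi> = 0" "horizontal X \<Longrightarrow> ip \<xi> X = 0"
  using eta_field_eq ip_commute[OF xi_field] by (auto simp: horizontal_def)

lemma ip_xi_xi: "ip \<xi> \<xi> = 1"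
  using eta_field_eq[OF xi_field] by (simp add: eta_field_xi)

lemma hor_iff: "horizontal X \<longleftrightarrow> vector_field A X \<and> ip X \<xi> = 0"
  using eta_field_eq by (auto simp: horizontal_def)

lemma hor_intros:
  "horizontal X \<Longrightarrow> horizontal Y \<Longrightarrow> horizontal (X + Y)"
  "horizontal X \<Longrightarrow> horizontal Y \<Longrightarrow> horizontal (X - Y)"
  "horizontal X \<Longrightarrow> horizontal (- X)"
  "smooth_fun A a \<Longrightarrow> horizontal X \<Longrightarrow> horizontal (a \<odot> X)"
  "vector_field A X \<Longrightarrow> horizontal (phi_field X)"
  by (auto simp: hor_iff ip_simps vector_field_intros xi_field ip_phi_left phi_field_xi vector_field_phi)

lemma phi_field_phi_hor: "horizontal X \<Longrightarrow> phi_field (phi_field X) = - X"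
  using phi_field_phi[of X] by (simp add: horizontal_def fscale_simps)

lemma ip_phi_phi: "vector_field A X \<Longrightarrow> horizontal Y \<Longrightarrow> ip (phi_field X) (phi_field Y) = ip X Y"
  by (simp add: ip_phi_left vector_field_phi phi_field_phi_hor hor_vf ip_minus_right)

end

section \<open>Dimension three\<close>

locale almost_contact_metric_3_manifold = almost_contact_metric_manifold A \<phi> \<xi> \<eta> g
  for A :: "('m::{t2_space, second_countable_topology}, real ^ 3) chart set"
    and \<phi> :: "'m \<Rightarrow> 'm tvec \<Rightarrow> 'm tvec"
    and \<xi> :: "'m vfield"
    and \<eta> :: "'m \<Rightarrow> 'm tvec \<Rightarrow> real"
    and g :: "'m \<Rightarrow> 'm tvec \<Rightarrow> 'm tvec \<Rightarrow> real"
begin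

text \<open>
  The difference of the two sides is orthogonal to \<open>\<xi>\<close>, \<open>e\<close> and \<open>\<phi>e\<close>. If it were not zero, these would be
  four linearly independent tangent vectors.
\<close>

lemma horizontal_frame:
  assumes e: "e \<in> tangent_space A p" "\<eta> p e = 0" and u: "u \<in> tangent_space A p" "\<eta> p u = 0"
  shows "g p e e *\<^sub>R u = g p u e *\<^sub>R e + g p u (\<phi> p e) *\<^sub>R \<phi> p e"
proof (cases "e = 0")
  case True
  then show ?thesis using e by (simp add: metric_zero_left phi_0)
next
  case False
  let ?f = "\<phi> p e"
  define w where "w = g p e e *\<^sub>R u - g p u e *\<^sub>R e - g p u ?f *\<^sub>R ?f"
  note [simp] = e u metric_diff_left metric_scale_left ts_intros metric_xi eta_phi eta_diff eta_scale
  have fe: "g p ?f e = 0" and ef: "g p e ?f = 0" and ff: "g p ?f ?f = g p e e"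
    using metric_phi_skew[OF e(1) e(1)] metric_sym[OF e(1) phi_tangent[OF e(1)]]
      metric_phi[OF e(1) e(1)] by auto
  have w: "w \<in> tangent_space A p" by (simp add: w_def)
  have we: "g p w e = 0" and wf: "g p w ?f = 0" and wx: "g p w (\<xi> p) = 0"
    by (simp_all add: w_def fe ef ff)
  have pos: "g p e e > 0" using metric_pos False by simp
  have ex: "g p e (\<xi> p) = 0" and fx: "g p ?f (\<xi> p) = 0" and xx: "g p (\<xi> p) (\<xi> p) = 1"
    by (simp_all add: eta_xi)
  have "w = 0"
  proof (rule ccontr)
    assume "w \<noteq> 0"
    then have ww: "g p w w > 0" using metric_pos w by simp
    let ?B = "{\<xi> p, e, ?f, w}"
    have "\<xi> p \<noteq> e" using e(2) eta_xi[of p] by (metis zero_neq_one)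
    then have distinct: "\<xi> p \<noteq> e" "\<xi> p \<noteq> ?f" "\<xi> p \<noteq> w" "e \<noteq> ?f" "e \<noteq> w" "?f \<noteq> w"
      using ex fx xx wx fe we wf ww pos e(2) by auto
    then have "card ?B = 4" by simp
    moreover have "independent ?B"
    proof (rule orthogonal_independent)
      show "?B \<subseteq> tangent_space A p" using w by simp
      have "g p 0 0 = 0" by (rule metric_zero_left[OF ts_0])
      then have nonzero: "x \<noteq> 0" if "g p x x > 0" for x using that by force
      show "0 \<notin> ?B"
        using nonzero[of "\<xi> p"] nonzero[OF pos] nonzero[of ?f] nonzero[OF ww] xx ff pos by auto
      show "g p a b = 0" if "a \<in> ?B" "b \<in> ?B" "a \<noteq> b" for a b
        using that ex fx wx fe ef we wf metric_sym w e xi_tangent phi_tangent by auto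
    qed simp
    ultimately show False
      using independent_in_tangent_space[OF manifold, of ?B p] w by simp
  qed
  then show ?thesis by (simp add: w_def algebra_simps)
qed

text \<open>
  This identity is what is left of the two-dimensionality of the horizontal planes: it replaces
  expansions in orthonormal frames in all that follows. If \<open>u \<noteq> 0\<close>, then \<open>u\<close> and \<open>\<phi>u\<close> span the plane, and
  both sides are compared after expanding \<open>v\<close> and \<open>z\<close>.
\<close>

lemma horizontal_plane_identity_pointwise:
  assumes u: "u \<in> tangent_space A p" "\<eta> p u = 0" and v: "v \<in> tangent_space A p" "\<eta> p v = 0"
    and z: "z \<in> tangent_space A p" "\<eta> p z = 0"
  shows "g p u z *\<^sub>R v - g p v z *\<^sub>R u = g p (\<phi> p u) v *\<^sub>R \<phi> p z"
proof (cases "u = 0")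
  case True
  then show ?thesis using v z by (simp add: phi_0 metric_zero_left)
next
  case False
  let ?s = "g p u u" and ?f = "\<phi> p u"
  note [simp] = u v z ts_intros metric_add_left metric_scale_left
  have pos: "?s > 0" using metric_pos False by simp
  have ff: "g p ?f ?f = ?s" and uf: "g p ?f u = 0"
    using metric_phi[OF u(1) u(1)] metric_phi_skew[OF u(1) u(1)] metric_sym[OF u(1) phi_tangent[OF u(1)]]
    by auto
  define a b c d where "a = g p v u / ?s" and "b = g p v ?f / ?s"
    and "c = g p z u / ?s" and "d = g p z ?f / ?s"
  have split: "x = (g p x u / ?s) *\<^sub>R u + (g p x ?f / ?s) *\<^sub>R ?f"
    if x: "x \<in> tangent_space A p" "\<eta> p x = 0" for x
  proof -
    have "inverse ?s *\<^sub>R (?s *\<^sub>R x) = inverse ?s *\<^sub>R (g p x u *\<^sub>R u + g p x ?f *\<^sub>R ?f)"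
      by (simp only: horizontal_frame[OF u x])
    then show ?thesis using pos by (simp add: scaleR_add_right divide_inverse mult.commute)
  qed
  have v': "v = a *\<^sub>R u + b *\<^sub>R ?f" and z': "z = c *\<^sub>R u + d *\<^sub>R ?f"
    unfolding a_def b_def c_def d_def by (rule split; use u v z in simp)+
  have \<phi>f: "\<phi> p ?f = - u" using phi_phi[OF u(1)] by simp
  have 1: "g p u z = c * ?s" "g p v z = (a * c + b * d) * ?s" "g p ?f v = b * ?s"
    using pos metric_sym[OF u(1) z(1)] metric_sym[OF phi_tangent[OF u(1)] v(1)]
      metric_sym[OF u(1) z(1)] metric_sym[OF phi_tangent[OF u(1)] z(1)]
    by (simp_all add: c_def b_def, subst v', simp add: a_def b_def c_def d_def field_simps)
  have 2: "\<phi> p z = c *\<^sub>R ?f - d *\<^sub>R u"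
    by (subst z') (simp add: phi_add phi_scale \<phi>f)
  show ?thesis unfolding 1 2 by (subst v') (simp add: algebra_simps)
qed

lemma horizontal_plane_identity:
  assumes "horizontal U" "horizontal V" "horizontal Z"
  shows "ip U Z \<odot> V - ip V Z \<odot> U = ip (phi_field U) V \<odot> phi_field Z"
proof
  fix p
  have "\<eta> p (X p) = 0" "X p \<in> tangent_space A p" if "horizontal X" for X
    using hor_eta[OF that] hor_vf[OF that] vector_field_in_tangent_space by (auto simp: ev1_def fun_eq_iff)
  then show "(ip U Z \<odot> V - ip V Z \<odot> U) p = (ip (phi_field U) V \<odot> phi_field Z) p"
    using horizontal_plane_identity_pointwise[of "U p" p "V p" "Z p"] assms
    by (simp add: fscale_def ev1_def ev2_def)
qed

text \<open>
  The diagonal condition says that \<open>T E\<close> vanishes where \<open>E\<close> does not. Where \<open>E\<close> vanishes, so does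
  \<open>g(T E, T E) = - g(E, T (T E))\<close>. In this way skew symmetry stands in for tensoriality.
\<close>

lemma skew_operator_vanishes:
  assumes T: "\<And>E. horizontal E \<Longrightarrow> horizontal (T E)"
    and skew: "\<And>E G. horizontal E \<Longrightarrow> horizontal G \<Longrightarrow> ip (T E) G = - ip E (T G)"
    and diag: "\<And>E. horizontal E \<Longrightarrow> ip E E \<odot> T E = 0"
    and E: "horizontal E"
  shows "T E = 0"
proof (rule ip_self_eq_0)
  show "vector_field A (T E)" using T[OF E] by (rule hor_vf)
  show "ip (T E) (T E) = 0"
  proof
    fix p
    show "ip (T E) (T E) p = 0 p"
    proof (cases "E p = 0")
      case True
      then show ?thesis
        using fun_cong[OF skew[OF E T[OF E]], of p] metric_zero_left[of "T (T E) p" p]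
          vector_field_in_tangent_space[OF hor_vf[OF T[OF T[OF E]]]]
        by (simp add: ev2_def)
    next
      case False
      then have "ip E E p \<noteq> 0"
        using metric_zero_iff vector_field_in_tangent_space[OF hor_vf[OF E]] by (simp add: ev2_def)
      then have "T E p = 0" using fun_cong[OF diag[OF E], of p] by (simp add: fscale_def)
      then show ?thesis
        using metric_zero_left[OF ts_0] by (simp add: ev2_def)
    qed
  qed
qed

end

section \<open>The leaves of the horizontal distribution\<close>

locale contact_levi_civita_3 =
  almost_contact_metric_3_manifold A \<phi> \<xi> \<eta> g + riemannian_levi_civita A g nabla
  for A :: "('m::{t2_space, second_countable_topology}, real ^ 3) chart set"
    and \<phi> :: "'m \<Rightarrow> 'm tvec \<Rightarrow> 'm tvec"
    and \<xi> :: "'m vfield"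
    and \<eta> :: "'m \<Rightarrow> 'm tvec \<Rightarrow> real"
    and g :: "'m \<Rightarrow> 'm tvec \<Rightarrow> 'm tvec \<Rightarrow> real"
    and nabla :: "'m vfield \<Rightarrow> 'm vfield \<Rightarrow> 'm vfield" +
  assumes d_eta: "\<And>X Y. vector_field A X \<Longrightarrow> vector_field A Y \<Longrightarrow> ext_deriv1 \<eta> X Y = 0"
begin

lemmas [simp] = fields xi_field vector_field_phi smooth_eta hor_vf hor_intros

lemma horI: "vector_field A X \<Longrightarrow> ip X \<xi> = 0 \<Longrightarrow> horizontal X"
  by (simp only: hor_iff)

text \<open>
  For horizontal \<open>X\<close> this is, up to sign, the shape operator of the leaves with unit normal \<open>\<xi>\<close>.
\<close>

abbreviation shape :: "'m vfield \<Rightarrow> 'm vfield" where "shape X \<equiv> nabla X \<xi>"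

lemma double_eq_0D: "a + a = (0 :: 'm \<Rightarrow> real) \<Longrightarrow> a = 0"
  by (auto simp: fun_eq_iff)

lemma ip_shape_xi: "vector_field A X \<Longrightarrow> ip (shape X) \<xi> = 0"
  using nabla_metric[of X \<xi> \<xi>] ip_commute[of "shape X" \<xi>]
  by - (rule double_eq_0D, simp add: ip_xi_xi dir_deriv_1)

lemma hor_shape [simp]: "vector_field A X \<Longrightarrow> horizontal (shape X)"
  by (rule horI) (simp_all add: ip_shape_xi)

text \<open>
  This is \<open>d\<eta> = 0\<close>, rewritten with the torsion-free connection.
\<close>

lemma shape_symmetric:
  assumes [simp]: "vector_field A X" "vector_field A Y"
  shows "ip (shape X) Y = ip X (shape Y)"
proof -
  have "dir_deriv X (ip Y \<xi>) - dir_deriv Y (ip X \<xi>) - ip (nabla X Y - nabla Y X) \<xi> = 0"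
    using d_eta[of X Y] by (simp add: ext_deriv1_def eta_field_eq lie_bracket_eq)
  then have "ip Y (shape X) = ip X (shape Y)"
    by (simp add: nabla_metric ip_simps)
  then show ?thesis by (simp add: ip_commute)
qed

lemma shape_xi: "shape \<xi> = 0"
  by (rule vector_field_eq_by_ip) (simp_all add: shape_symmetric ip_zero_left hor_ip_xi)

lemma eta_nabla:
  assumes [simp]: "vector_field A X" "horizontal Y"
  shows "eta_field (nabla X Y) = - ip (shape X) Y"
proof -
  have "dir_deriv X (ip Y \<xi>) = ip (nabla X Y) \<xi> + ip Y (shape X)"
    by (rule nabla_metric) simp_all
  then show ?thesis
    by (simp add: hor_ip_xi dir_deriv_0 eta_field_eq ip_commute[of Y] eq_neg_iff_add_eq_0)
qed

lemma ip_nabla_xi: "vector_field A X \<Longrightarrow> horizontal Y \<Longrightarrow> ip (nabla X Y) \<xi> = - ip (shape X) Y"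
  using eta_nabla[of X Y] by (simp only: eta_field_eq vector_field_nabla hor_vf)

lemma ip_phi_swap: "vector_field A X \<Longrightarrow> vector_field A Y \<Longrightarrow> ip X (phi_field Y) = - ip Y (phi_field X)"
  using ip_phi_left[of X Y] ip_commute[of "phi_field X" Y] by simp

text \<open>
  For horizontal \<open>X\<close> and \<open>Y\<close> this is the Levi-Civita connection of the leaves. It is used for arbitrary
  \<open>X\<close>, since differentiating horizontal fields along \<open>\<xi>\<close> is needed too.
\<close>

definition leaf_nabla :: "'m vfield \<Rightarrow> 'm vfield \<Rightarrow> 'm vfield" where
  "leaf_nabla X Y = nabla X Y - eta_field (nabla X Y) \<odot> \<xi>"

lemma nabla_eq_leaf: "vector_field A X \<Longrightarrow> horizontal Y \<Longrightarrow> nabla X Y = leaf_nabla X Y - ip (shape X) Y \<odot> \<xi>"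
  by (simp add: leaf_nabla_def eta_nabla fscale_simps)

lemma hor_leaf [simp]: "vector_field A X \<Longrightarrow> horizontal Y \<Longrightarrow> horizontal (leaf_nabla X Y)"
  by (rule horI) (simp_all add: leaf_nabla_def ip_simps ip_xi_xi eta_field_eq)

lemma leaf_metric:
  assumes [simp]: "vector_field A X" "horizontal Y" "horizontal Z"
  shows "dir_deriv X (ip Y Z) = ip (leaf_nabla X Y) Z + ip Y (leaf_nabla X Z)"
  by (simp add: nabla_metric leaf_nabla_def ip_simps hor_ip_xi)

lemma leaf_add: "vector_field A X \<Longrightarrow> horizontal Y \<Longrightarrow> horizontal Z \<Longrightarrow> leaf_nabla X (Y + Z) = leaf_nabla X Y + leaf_nabla X Z"
  and leaf_minus: "vector_field A X \<Longrightarrow> horizontal Y \<Longrightarrow> leaf_nabla X (- Y) = - leaf_nabla X Y"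
  by (simp_all add: leaf_nabla_def nabla_simps eta_field_eq ip_simps fscale_simps)

lemma leaf_fscale:
  "smooth_fun A a \<Longrightarrow> vector_field A X \<Longrightarrow> horizontal Y \<Longrightarrow>
    leaf_nabla X (a \<odot> Y) = dir_deriv X a \<odot> Y + a \<odot> leaf_nabla X Y"
  by (simp add: leaf_nabla_def nabla_simps eta_field_eq ip_simps fscale_simps hor_ip_xi)

lemma hor_lie_bracket [simp]: "horizontal X \<Longrightarrow> horizontal Y \<Longrightarrow> horizontal (lie_bracket X Y)"
  using shape_symmetric[of X Y] ip_commute[of "shape Y" X]
  by - (rule horI, simp_all add: lie_bracket_eq ip_simps ip_nabla_xi)

lemma lie_bracket_leaf: "horizontal X \<Longrightarrow> horizontal Y \<Longrightarrow> lie_bracket X Y = leaf_nabla X Y - leaf_nabla Y X"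
  using shape_symmetric[of X Y] ip_commute[of "shape Y" X]
  by (simp add: lie_bracket_eq nabla_eq_leaf)

text \<open>
  On a surface the rotation by a right angle is parallel. The commutator \<open>T\<close> of the derivative with \<open>\<phi>\<close>
  is skew because \<open>\<phi>\<close> is, which gives \<open>g(T E, E) = 0\<close>, and \<open>g(\<phi>E, T E) = 0\<close> follows from differentiating
  \<open>g(\<phi>E, \<phi>E) = g(E, E)\<close>. In a plane this forces \<open>T E = 0\<close> wherever \<open>E\<close> does not vanish.
\<close>

lemma leaf_phi:
  assumes [simp]: "vector_field A X" "horizontal Y"
  shows "leaf_nabla X (phi_field Y) = phi_field (leaf_nabla X Y)"
proof -
  define T where "T E = leaf_nabla X (phi_field E) - phi_field (leaf_nabla X E)" for E
  have T [simp]: "horizontal (T E)" if "horizontal E" for E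
    using that by (simp add: T_def)
  have skew: "ip (T E) G = - ip E (T G)" if [simp]: "horizontal E" "horizontal G" for E G
  proof -
    have "dir_deriv X (ip (phi_field E) G) = - dir_deriv X (ip E (phi_field G))"
      by (simp add: ip_phi_left dir_deriv_minus)
    moreover have "dir_deriv X (ip (phi_field E) G) =
        ip (leaf_nabla X (phi_field E)) G + ip (phi_field E) (leaf_nabla X G)"
      by (rule leaf_metric) simp_all
    moreover have "dir_deriv X (ip E (phi_field G)) =
        ip (leaf_nabla X E) (phi_field G) + ip E (leaf_nabla X (phi_field G))"
      by (rule leaf_metric) simp_all
    ultimately show ?thesis
      by (simp add: T_def ip_simps ip_phi_left dir_deriv_minus algebra_simps)
  qed
  have diag: "ip E E \<odot> T E = 0" if [simp]: "horizontal E" for E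
  proof -
    have 1: "ip (T E) E = 0"
      using skew[of E E] ip_commute[of E "T E"] by - (rule double_eq_0D, simp)
    have "ip (leaf_nabla X (phi_field E)) (phi_field E) + ip (phi_field E) (leaf_nabla X (phi_field E)) =
        ip (leaf_nabla X E) E + ip E (leaf_nabla X E)"
      using leaf_metric[of X "phi_field E" "phi_field E"] leaf_metric[of X E E] by (simp add: ip_phi_phi)
    then have "ip (phi_field E) (T E) + ip (phi_field E) (T E) = 0"
      using ip_commute[of "leaf_nabla X E" E] ip_commute[of "leaf_nabla X (phi_field E)" "phi_field E"]
      by (simp add: T_def ip_simps ip_phi_phi)
    then have 2: "ip (phi_field E) (T E) = 0" by (rule double_eq_0D)
    show ?thesis
      using horizontal_plane_identity[of E "T E" E] by (simp add: 1 2 fscale_simps)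
  qed
  have "T Y = 0" by (rule skew_operator_vanishes[OF T skew diag]) simp_all
  then show ?thesis by (simp add: T_def)
qed

lemma hor_projection [simp]: "vector_field A X \<Longrightarrow> horizontal (X - eta_field X \<odot> \<xi>)"
  by (rule horI) (simp_all add: ip_simps ip_xi_xi eta_field_eq)

text \<open>
  Integral curves of \<open>\<xi>\<close> are geodesics (\<open>shape_xi\<close>), so differentiation along \<open>\<xi>\<close> preserves the horizontal
  fields and coincides there with the projected derivative.
\<close>

lemma nabla_xi_phi:
  assumes [simp]: "vector_field A X"
  shows "nabla \<xi> (phi_field X) = phi_field (nabla \<xi> X)"
proof -
  let ?Y = "X - eta_field X \<odot> \<xi>"
  have nabla: "nabla \<xi> Y = leaf_nabla \<xi> Y" if "horizontal Y" for Y
    using that by (simp add: nabla_eq_leaf shape_xi ip_zero_left fscale_simps)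
  have "phi_field (nabla \<xi> ?Y) = nabla \<xi> (phi_field ?Y)"
    by (simp add: nabla leaf_phi)
  then show ?thesis
    by (simp add: nabla_simps phi_simps shape_xi fscale_simps)
qed

end

section \<open>The shape operator of the leaves\<close>

text \<open>
  The structures of this kind are known as almost \<open>\<alpha>\<close>-cosymplectic; \<open>\<alpha> = 0\<close> is the almost
  cosymplectic and \<open>\<alpha> = 1\<close> the almost Kenmotsu case.
\<close>

locale almost_alpha_cosymplectic_3 = contact_levi_civita_3 A \<phi> \<xi> \<eta> g nabla
  for A :: "('m::{t2_space, second_countable_topology}, real ^ 3) chart set"
    and \<phi> :: "'m \<Rightarrow> 'm tvec \<Rightarrow> 'm tvec"
    and \<xi> :: "'m vfield"
    and \<eta> :: "'m \<Rightarrow> 'm tvec \<Rightarrow> real"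
    and g :: "'m \<Rightarrow> 'm tvec \<Rightarrow> 'm tvec \<Rightarrow> real"
    and nabla :: "'m vfield \<Rightarrow> 'm vfield \<Rightarrow> 'm vfield" +
  fixes \<alpha> :: real
  assumes d_Phi: "\<And>X Y Z. vector_field A X \<Longrightarrow> vector_field A Y \<Longrightarrow> vector_field A Z \<Longrightarrow>
    ext_deriv2 (fundamental_form \<phi> g) X Y Z =
      (\<lambda>_. 2 * \<alpha>) * wedge12 \<eta> (fundamental_form \<phi> g) X Y Z"
begin

abbreviation alpha :: "'m \<Rightarrow> real" where "alpha \<equiv> (\<lambda>_. \<alpha>)"

lemma smooth_2_alpha [simp]: "smooth_fun A (2 * alpha)"
  using smooth_const[of 2] by (simp add: numeral_fun)

text \<open>
  Insert \<open>\<xi>\<close> as first argument into \<open>d\<Phi> = 2\<alpha> \<eta> \<and> \<Phi>\<close>. The left-hand side becomes the Lie derivative of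
  \<open>\<Phi>\<close> along \<open>\<xi>\<close>, in which the covariant derivatives along \<open>\<xi>\<close> cancel because \<open>\<phi>\<close> is parallel in that
  direction.
\<close>

lemma shape_phi:
  assumes [simp]: "vector_field A X"
  shows "shape (phi_field X) = (2 * alpha) \<odot> phi_field X - phi_field (shape X)"
proof (rule vector_field_eq_by_ip)
  fix Y assume Y [simp]: "vector_field A Y"
  have \<Phi>: "ev2 (fundamental_form \<phi> g) V W = ip V (phi_field W)" for V W
    by (simp add: ev2_def ev1_def fundamental_form_def)
  have 0: "ip \<xi> (phi_field W) = 0" if "vector_field A W" for W
    using that ip_phi_left[of \<xi> W] by (simp add: phi_field_xi ip_zero_left)
  have 2: "(\<lambda>_. 2 * \<alpha>) = 2 * alpha" by (simp add: fun_eq_iff)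
  have rhs: "ip Y ((2 * alpha) \<odot> phi_field X - phi_field (shape X)) =
      2 * alpha * ip Y (phi_field X) - ip Y (phi_field (shape X))"
    by (simp add: ip_simps)
  have "dir_deriv \<xi> (ip Y (phi_field X)) - ip (lie_bracket \<xi> Y) (phi_field X)
      + ip (lie_bracket \<xi> X) (phi_field Y) = 2 * alpha * ip Y (phi_field X)"
    using d_Phi[of \<xi> Y X]
    by (simp add: ext_deriv2_def wedge12_def \<Phi> 0 2 phi_field_xi ip_zero_right eta_field_xi dir_deriv_0)
  moreover have "ip (lie_bracket \<xi> X) (phi_field Y) = - ip Y (phi_field (lie_bracket \<xi> X))"
    by (rule ip_phi_swap) simp_all
  moreover have "ip (shape Y) (phi_field X) = ip Y (shape (phi_field X))"
    by (rule shape_symmetric) simp_all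
  ultimately have "ip Y (shape (phi_field X)) = ip Y ((2 * alpha) \<odot> phi_field X - phi_field (shape X))"
    unfolding rhs
    using ip_phi_swap[of "nabla \<xi> X" Y] ip_phi_swap[of "shape X" Y]
    by (simp add: nabla_metric lie_bracket_eq ip_simps phi_simps nabla_xi_phi algebra_simps)
  then show "ip (shape (phi_field X)) Y = ip ((2 * alpha) \<odot> phi_field X - phi_field (shape X)) Y"
    using ip_commute[of _ Y] by simp
qed simp_all

lemma h_op_eq:
  assumes [simp]: "vector_field A X"
  shows "h_op \<phi> \<xi> X = phi_field (shape X) - alpha \<odot> phi_field X"
proof -
  have L: "lie_deriv_tensor11 \<xi> \<phi> X = phi_field (shape X) - shape (phi_field X)"
    by (simp add: lie_deriv_tensor11_def lie_bracket_eq phi_simps nabla_xi_phi)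
  have "h_op \<phi> \<xi> X p f = (phi_field (shape X) - alpha \<odot> phi_field X) p f" for p f
    using fun_cong[OF fun_cong[OF L, of p], of f]
    by (simp add: h_op_def shape_phi fscale_def algebra_simps)
  then show ?thesis by blast
qed

lemma phi_h_op_eq:
  assumes [simp]: "vector_field A X"
  shows "phi_h_op \<phi> \<xi> X = alpha \<odot> (X - eta_field X \<odot> \<xi>) - shape X"
  by (simp add: phi_h_op_def h_op_eq phi_simps phi_field_phi_hor[of "shape X"] phi_field_phi[of X]
      fscale_simps algebra_simps)

text \<open>
  By \<open>shape_phi\<close> the trace of the shape operator on the horizontal planes is \<open>2\<alpha>\<close>, so on horizontal
  fields this is its trace-free part.
\<close>

definition shape0 :: "'m vfield \<Rightarrow> 'm vfield" where
  "shape0 X = shape X - alpha \<odot> X"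

lemma hor_shape0 [simp]: "horizontal X \<Longrightarrow> horizontal (shape0 X)"
  by (simp add: shape0_def)

lemma shape_eq: "shape X = shape0 X + alpha \<odot> X"
  by (simp add: shape0_def)

lemma shape0_diff: "horizontal X \<Longrightarrow> horizontal Y \<Longrightarrow> shape0 (X - Y) = shape0 X - shape0 Y"
  and shape0_minus: "horizontal X \<Longrightarrow> shape0 (- X) = - shape0 X"
  and shape0_0: "shape0 0 = 0"
  by (simp_all add: shape0_def nabla_simps fscale_simps algebra_simps)

lemma shape0_phi: "horizontal X \<Longrightarrow> shape0 (phi_field X) = - phi_field (shape0 X)"
  by (simp add: shape0_def shape_phi phi_simps) (simp add: fun_eq_iff fscale_def algebra_simps)

lemma shape0_symmetric: "horizontal X \<Longrightarrow> horizontal Y \<Longrightarrow> ip (shape0 X) Y = ip X (shape0 Y)"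
  by (simp add: shape0_def ip_simps shape_symmetric)

lemma h_op_hor: "horizontal X \<Longrightarrow> h_op \<phi> \<xi> X = phi_field (shape0 X)"
  by (simp add: h_op_eq shape0_def phi_simps)

lemma phi_h_op_hor: "horizontal X \<Longrightarrow> phi_h_op \<phi> \<xi> X = - shape0 X"
  by (simp add: phi_h_op_eq shape0_def hor_eta fscale_simps)

end

section \<open>Flatness of the leaves\<close>

locale leafwise_constant_kappa_space =
  almost_alpha_cosymplectic_3 A \<phi> \<xi> \<eta> g nabla \<alpha> + kappa_mu_nu_space A \<phi> \<xi> \<eta> g nabla \<kappa> \<mu> \<nu>
  for A :: "('m::{t2_space, second_countable_topology}, real ^ 3) chart set"
    and \<phi> :: "'m \<Rightarrow> 'm tvec \<Rightarrow> 'm tvec"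
    and \<xi> :: "'m vfield"
    and \<eta> :: "'m \<Rightarrow> 'm tvec \<Rightarrow> real"
    and g :: "'m \<Rightarrow> 'm tvec \<Rightarrow> 'm tvec \<Rightarrow> real"
    and nabla :: "'m vfield \<Rightarrow> 'm vfield \<Rightarrow> 'm vfield"
    and \<alpha> :: real and \<kappa> \<mu> \<nu> :: "'m \<Rightarrow> real" +
  assumes kappa_leafwise_constant: "\<And>X. horizontal X \<Longrightarrow> dir_deriv X \<kappa> = 0"
    and kappa_less: "\<And>p. \<kappa> p < - \<alpha>\<^sup>2"
begin

lemmas [simp] = smooth_coefficients

lemma hor_nabla_xi [simp]: "horizontal Y \<Longrightarrow> horizontal (nabla \<xi> Y)"
  using hor_leaf[of \<xi> Y] nabla_eq_leaf[of \<xi> Y] by (simp add: shape_xi ip_zero_left fscale_simps)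

lemma curvature_xi_xi:
  assumes [simp]: "horizontal X"
  shows "curvature nabla X \<xi> \<xi> = \<kappa> \<odot> X + \<mu> \<odot> phi_field (shape0 X) - \<nu> \<odot> shape0 X"
  by (simp add: curvature_xi eta_field_xi hor_eta h_op_hor phi_h_op_hor fscale_simps)

lemma curvature_hor_xi:
  assumes [simp]: "horizontal X" "horizontal Y"
  shows "curvature nabla X Y \<xi> = 0"
  by (simp add: curvature_xi hor_eta fscale_simps)

text \<open>
  The Riccati equation of the shape operator along \<open>\<xi>\<close>: the left-hand side is \<open>\<nabla>\<^sub>\<xi> B + B\<^sup>2\<close> with \<open>B = \<alpha> + S\<close>
  multiplied out, the right-hand side is the given value of \<open>- R(X,\<xi>)\<xi>\<close>.
\<close>

lemma riccati:
  assumes [simp]: "horizontal X"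
  shows "(nabla \<xi> (shape0 X) - shape0 (nabla \<xi> X)) + (alpha * alpha) \<odot> X + (2 * alpha) \<odot> shape0 X + shape0 (shape0 X) =
    - (\<kappa> \<odot> X + \<mu> \<odot> phi_field (shape0 X) - \<nu> \<odot> shape0 X)"
proof -
  have "curvature nabla X \<xi> \<xi> = - nabla \<xi> (shape X) - shape (shape X) + shape (nabla \<xi> X)"
    by (simp add: curvature_def shape_xi nabla_simps lie_bracket_eq)
  then have "\<kappa> \<odot> X + \<mu> \<odot> phi_field (shape0 X) - \<nu> \<odot> shape0 X =
      - nabla \<xi> (shape0 X + alpha \<odot> X) - shape (shape0 X + alpha \<odot> X) + shape (nabla \<xi> X)"
    by (simp only: curvature_xi_xi[OF assms] shape_eq[of X])
  then show ?thesis
    by (simp add: nabla_simps dir_deriv_const fscale_simps shape_eq[of "shape0 X"] shape_eq[of X]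
        shape_eq[of "nabla \<xi> X"])
      (simp add: fun_eq_iff fscale_def algebra_simps)
qed

text \<open>
  The Riccati equation consists of parts that commute with \<open>\<phi>\<close>, namely \<open>\<alpha>\<^sup>2\<close>, \<open>S\<^sup>2\<close> and \<open>\<kappa>\<close>, and parts that
  anticommute with \<open>\<phi>\<close>, namely \<open>\<nabla>\<^sub>\<xi> S\<close>, \<open>2\<alpha>S\<close> and the terms with \<open>\<mu>\<close> and \<open>\<nu>\<close>. Adding \<open>\<phi>\<close> of the
  equation for \<open>X\<close> to the equation for \<open>\<phi>X\<close> isolates the former.
\<close>

lemma shape0_squared:
  assumes [simp]: "horizontal X"
  shows "shape0 (shape0 X) = (- (\<kappa> + alpha * alpha)) \<odot> X"
proof -
  let ?J = "nabla \<xi> (shape0 X) - shape0 (nabla \<xi> X)"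
  have "phi_field (?J + (alpha * alpha) \<odot> X + (2 * alpha) \<odot> shape0 X + shape0 (shape0 X)) =
      phi_field (- (\<kappa> \<odot> X + \<mu> \<odot> phi_field (shape0 X) - \<nu> \<odot> shape0 X))"
    by (simp only: riccati[OF assms])
  then have 1: "phi_field ?J + (alpha * alpha) \<odot> phi_field X + (2 * alpha) \<odot> phi_field (shape0 X)
      + phi_field (shape0 (shape0 X)) = - (\<kappa> \<odot> phi_field X - \<mu> \<odot> shape0 X - \<nu> \<odot> phi_field (shape0 X))"
    by (simp add: phi_simps phi_field_phi_hor fscale_simps)
  have "nabla \<xi> (shape0 (phi_field X)) - shape0 (nabla \<xi> (phi_field X)) = - phi_field ?J"
    by (simp add: shape0_phi nabla_xi_phi nabla_simps phi_simps)
  then have 2: "- phi_field ?J + (alpha * alpha) \<odot> phi_field X - (2 * alpha) \<odot> phi_field (shape0 X)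
      + phi_field (shape0 (shape0 X)) = - (\<kappa> \<odot> phi_field X + \<mu> \<odot> shape0 X + \<nu> \<odot> phi_field (shape0 X))"
    using riccati[of "phi_field X"]
    by (simp add: shape0_phi shape0_minus phi_simps phi_field_phi_hor fscale_simps)
  have "phi_field (shape0 (shape0 X)) p f = ((- (\<kappa> + alpha * alpha)) \<odot> phi_field X) p f" for p f
    using fun_cong[OF fun_cong[OF 1, of p], of f] fun_cong[OF fun_cong[OF 2, of p], of f]
    by (simp add: fscale_def algebra_simps)
  then have "phi_field (shape0 (shape0 X)) = (- (\<kappa> + alpha * alpha)) \<odot> phi_field X" by blast
  then have "phi_field (phi_field (shape0 (shape0 X))) = phi_field ((- (\<kappa> + alpha * alpha)) \<odot> phi_field X)"
    by (rule arg_cong)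
  then have "- shape0 (shape0 X) = - ((- (\<kappa> + alpha * alpha)) \<odot> X)"
    by (simp add: phi_simps phi_field_phi_hor fscale_simps)
  then show ?thesis by (simp only: neg_equal_iff_equal)
qed

text \<open>
  The square of the eigenvalues \<open>\<plusminus>\<lambda>\<close> of \<open>h\<close> on the horizontal planes; it is positive by the assumption
  on \<open>\<kappa>\<close>.
\<close>

abbreviation lambda_sq :: "'m \<Rightarrow> real" where "lambda_sq \<equiv> - (\<kappa> + alpha * alpha)"

lemma lambda_sq_pos: "lambda_sq p > 0"
  using kappa_less[of p] by (simp add: power2_eq_square)

lemma lambda_sq_cancel: "lambda_sq \<odot> X = 0 \<Longrightarrow> X = 0"
proof
  fix p assume "lambda_sq \<odot> X = 0"
  from fun_cong[OF this, of p] have "lambda_sq p *\<^sub>R X p = 0" by (simp add: fscale_def)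
  then show "X p = 0 p" using lambda_sq_pos[of p] by (metis scaleR_eq_0_iff less_irrefl zero_fun_apply)
qed

lemma vfield_eq_minus_self: "(X :: 'm vfield) = - X \<Longrightarrow> X = 0"
  by (simp add: fun_eq_iff)

text \<open>
  The covariant derivative \<open>(D\<^sub>X S)Y\<close> along the leaves.
\<close>

definition leaf_deriv_shape0 :: "'m vfield \<Rightarrow> 'm vfield \<Rightarrow> 'm vfield" where
  "leaf_deriv_shape0 X Y = leaf_nabla X (shape0 Y) - shape0 (leaf_nabla X Y)"

lemma hor_leaf_deriv_shape0 [simp]: "horizontal X \<Longrightarrow> horizontal Y \<Longrightarrow> horizontal (leaf_deriv_shape0 X Y)"
  by (simp add: leaf_deriv_shape0_def)

text \<open>
  The Codazzi equation. The normal parts of \<open>\<nabla>\<^sub>X (BY)\<close> and \<open>\<nabla>\<^sub>Y (BX)\<close> are both \<open>- g(BX, BY) \<xi>\<close> and cancel,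
  so \<open>R(X,Y)\<xi> = 0\<close> is an equation on the leaf; the multiple \<open>\<alpha>\<close> of the identity in \<open>B\<close> is parallel.
\<close>

lemma leaf_deriv_shape0_symmetric:
  assumes [simp]: "horizontal X" "horizontal Y"
  shows "leaf_deriv_shape0 X Y = leaf_deriv_shape0 Y X"
proof -
  have "nabla X (shape Y) - nabla Y (shape X) - shape (lie_bracket X Y) = 0"
    using curvature_hor_xi[of X Y] by (simp add: curvature_def)
  then have "leaf_nabla X (shape Y) - leaf_nabla Y (shape X) - shape (leaf_nabla X Y - leaf_nabla Y X) = 0"
    using ip_commute[of "shape X" "shape Y"]
    by (simp add: nabla_eq_leaf[of X "shape Y"] nabla_eq_leaf[of Y "shape X"] lie_bracket_leaf)
  then have "leaf_nabla X (shape0 Y + alpha \<odot> Y) - leaf_nabla Y (shape0 X + alpha \<odot> X)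
      - (shape0 (leaf_nabla X Y - leaf_nabla Y X) + alpha \<odot> (leaf_nabla X Y - leaf_nabla Y X)) = 0"
    by (simp only: shape_eq)
  then show ?thesis
    by (simp add: leaf_deriv_shape0_def leaf_add leaf_fscale dir_deriv_const shape0_diff fscale_simps algebra_simps)
qed

lemma leaf_deriv_shape0_phi: "horizontal X \<Longrightarrow> horizontal Y \<Longrightarrow> leaf_deriv_shape0 X (phi_field Y) = - phi_field (leaf_deriv_shape0 X Y)"
  by (simp add: leaf_deriv_shape0_def shape0_phi leaf_phi leaf_minus phi_simps)

text \<open>
  The derivative of \<open>S\<^sup>2\<close> vanishes because \<open>S\<^sup>2\<close> is a multiple of the identity that is constant along
  the leaves. This is the only place where the condition on the derivatives of \<open>\<kappa>\<close> enters.
\<close>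

lemma leaf_deriv_shape0_shape0:
  assumes [simp]: "horizontal X" "horizontal Y"
  shows "leaf_deriv_shape0 X (shape0 Y) = - shape0 (leaf_deriv_shape0 X Y)"
proof -
  have "dir_deriv X lambda_sq = 0"
    by (simp add: dir_deriv_diff dir_deriv_minus dir_deriv_mult dir_deriv_const kappa_leafwise_constant)
  then have "leaf_nabla X (lambda_sq \<odot> Y) = lambda_sq \<odot> leaf_nabla X Y"
    by (simp only: leaf_fscale smooth_intros smooth_coefficients hor_vf assms fscale_zero_left add_0)
  then show ?thesis
    by (simp only: leaf_deriv_shape0_def shape0_squared shape0_diff hor_shape0 hor_leaf hor_vf assms minus_diff_eq)
qed

text \<open>
  Write \<open>A X Y\<close> for \<open>(D\<^sub>X S)Y\<close>. Being symmetric, it anticommutes with \<open>\<phi>\<close> in either argument. Hence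
  \<open>A (\<phi>X) (SY)\<close> is \<open>- S (A (\<phi>X) Y) = S (\<phi> (A X Y)) = - \<phi> (S (A X Y))\<close> on the one hand and
  \<open>- \<phi> (A X (SY)) = \<phi> (S (A X Y))\<close> on the other, and both \<open>\<phi>\<close> and \<open>S\<close> are invertible.
\<close>

lemma leaf_deriv_shape0_eq_0:
  assumes [simp]: "horizontal X" "horizontal Y"
  shows "leaf_deriv_shape0 X Y = 0"
proof -
  have "leaf_deriv_shape0 (phi_field X) Y = - phi_field (leaf_deriv_shape0 X Y)"
    using leaf_deriv_shape0_phi[of Y X] leaf_deriv_shape0_symmetric[of "phi_field X" Y] leaf_deriv_shape0_symmetric[of X Y] by simp
  then have 1: "leaf_deriv_shape0 (phi_field X) (shape0 Y) = - phi_field (shape0 (leaf_deriv_shape0 X Y))"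
    by (simp add: leaf_deriv_shape0_shape0 shape0_minus shape0_phi)
  have "leaf_deriv_shape0 (phi_field X) (shape0 Y) = - phi_field (leaf_deriv_shape0 X (shape0 Y))"
    using leaf_deriv_shape0_phi[of "shape0 Y" X] leaf_deriv_shape0_symmetric[of "phi_field X" "shape0 Y"] leaf_deriv_shape0_symmetric[of X "shape0 Y"] by simp
  also have "\<dots> = phi_field (shape0 (leaf_deriv_shape0 X Y))" by (simp add: leaf_deriv_shape0_shape0 phi_simps)
  finally have "phi_field (shape0 (leaf_deriv_shape0 X Y)) = - phi_field (shape0 (leaf_deriv_shape0 X Y))" using 1 by simp
  then have "phi_field (shape0 (leaf_deriv_shape0 X Y)) = 0" by (rule vfield_eq_minus_self)
  then have "phi_field (phi_field (shape0 (leaf_deriv_shape0 X Y))) = phi_field 0" by (rule arg_cong)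
  then have "shape0 (leaf_deriv_shape0 X Y) = 0" by (simp add: phi_field_phi_hor phi_field_0)
  then have "shape0 (shape0 (leaf_deriv_shape0 X Y)) = 0" by (simp add: shape0_0)
  then have "lambda_sq \<odot> leaf_deriv_shape0 X Y = 0" by (simp only: shape0_squared hor_leaf_deriv_shape0 assms)
  then show ?thesis by (rule lambda_sq_cancel)
qed

lemma leaf_shape0: "horizontal X \<Longrightarrow> horizontal Y \<Longrightarrow> leaf_nabla X (shape0 Y) = shape0 (leaf_nabla X Y)"
  using leaf_deriv_shape0_eq_0[of X Y] by (simp add: leaf_deriv_shape0_def)

text \<open>
  The curvature operator \<open>K\<close> of the leaf is skew and commutes with \<open>\<phi>\<close> and \<open>S\<close>, since both are parallel.
  So \<open>g(K E, S E)\<close> and \<open>g(K E, \<phi> (S E))\<close> equal their own negatives, \<open>S\<close> and \<open>\<phi> \<circ> S\<close> being symmetric.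
  Where \<open>E\<close> does not vanish, \<open>S E\<close> and \<open>\<phi> (S E)\<close> span the horizontal plane, so \<open>K E = 0\<close>.
\<close>

lemma leaf_flat:
  assumes [simp]: "horizontal X" "horizontal Y" and Z: "horizontal Z"
  shows "leaf_nabla X (leaf_nabla Y Z) - leaf_nabla Y (leaf_nabla X Z) - leaf_nabla (lie_bracket X Y) Z = 0"
proof -
  define K where "K Z = leaf_nabla X (leaf_nabla Y Z) - leaf_nabla Y (leaf_nabla X Z) - leaf_nabla (lie_bracket X Y) Z" for Z
  have K [simp]: "horizontal (K Z)" if "horizontal Z" for Z using that by (simp add: K_def)
  have KS: "K (shape0 Z) = shape0 (K Z)" and KF: "K (phi_field Z) = phi_field (K Z)" if "horizontal Z" for Z
    using that by (simp_all add: K_def leaf_shape0 leaf_phi shape0_diff phi_simps)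
  have skew: "ip (K E) G = - ip E (K G)" if "horizontal E" "horizontal G" for E G
    unfolding K_def
    by (rule metric_derivation_curvature_skew[where H = "Collect horizontal" and X = X and Y = Y
          and DX = "leaf_nabla X" and DY = "leaf_nabla Y" and DXY = "leaf_nabla (lie_bracket X Y)"])
      (use that in \<open>simp_all add: leaf_metric\<close>)
  have diag: "ip E E \<odot> K E = 0" if [simp]: "horizontal E" for E
  proof -
    have "ip (K E) (shape0 E) = ip (K (shape0 E)) E" by (simp add: KS shape0_symmetric)
    also have "\<dots> = - ip (K E) (shape0 E)" using skew[of "shape0 E" E] ip_commute[of "shape0 E" "K E"] by simp
    finally have 1: "ip (K E) (shape0 E) = 0" by - (rule double_eq_0D, simp)
    have "ip (phi_field (shape0 E)) (K E) = - ip (shape0 E) (K (phi_field E))" by (simp add: KF ip_phi_left)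
    also have "\<dots> = ip (K (shape0 E)) (phi_field E)" using skew[of "shape0 E" "phi_field E"] by simp
    also have "\<dots> = - ip (phi_field (shape0 E)) (K E)"
      using ip_commute[of "phi_field (shape0 E)" "K E"] by (simp add: KS shape0_symmetric shape0_phi ip_simps)
    finally have 2: "ip (phi_field (shape0 E)) (K E) = 0" by - (rule double_eq_0D, simp)
    have "ip (shape0 E) (shape0 E) = lambda_sq * ip E E"
      by (simp only: shape0_symmetric shape0_squared that hor_shape0 ip_fscale_right hor_vf)
    then have "lambda_sq \<odot> (ip E E \<odot> K E) = 0"
      using horizontal_plane_identity[of "shape0 E" "K E" "shape0 E"] by (simp add: 1 2 fscale_simps)
    then show ?thesis by (rule lambda_sq_cancel)
  qed
  have "K Z = 0" by (rule skew_operator_vanishes[OF K skew diag Z])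
  then show ?thesis by (simp add: K_def)
qed

text \<open>
  The extrinsic terms of the Gauss equation alone, the leaves being flat. The normal part \<open>w\<close> of the
  curvature vanishes because \<open>R(X,Y)\<xi> = 0\<close>.
\<close>

lemma gauss_equation:
  assumes [simp]: "horizontal X" "horizontal Y" "horizontal Z"
  shows "curvature nabla X Y Z = ip (shape X) Z \<odot> shape Y - ip (shape Y) Z \<odot> shape X"
proof -
  let ?b = "\<lambda>V W. ip (shape V) W"
  \<comment> \<open>The coefficient of \<open>\<xi>\<close> that results from expanding both covariant derivatives.\<close>
  define w where "w = ?b Y (leaf_nabla X Z) - ?b X (leaf_nabla Y Z) - dir_deriv X (?b Y Z) + dir_deriv Y (?b X Z)
    + ?b (lie_bracket X Y) Z"
  have "curvature nabla X Y Z = (leaf_nabla X (leaf_nabla Y Z) - leaf_nabla Y (leaf_nabla X Z) - leaf_nabla (lie_bracket X Y) Z)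
      + ?b X Z \<odot> shape Y - ?b Y Z \<odot> shape X + w \<odot> \<xi>"
    unfolding curvature_def w_def
    by (simp add: nabla_eq_leaf[of _ Z] nabla_eq_leaf[of _ "leaf_nabla _ Z"] nabla_simps fscale_simps algebra_simps)
  then have R: "curvature nabla X Y Z = ?b X Z \<odot> shape Y - ?b Y Z \<odot> shape X + w \<odot> \<xi>"
    by (simp add: leaf_flat)
  have [simp]: "smooth_fun A w" by (simp add: w_def)
  have "ip (curvature nabla X Y Z) \<xi> = 0"
    by (simp add: curvature_skew curvature_hor_xi ip_zero_right)
  then have "w = 0" unfolding R by (simp add: ip_simps ip_shape_xi ip_xi_xi)
  then show ?thesis by (simp add: R fscale_simps)
qed

section \<open>The curvature tensor\<close>

text \<open>
  For \<open>X' = T X\<close> and \<open>Y' = T Y\<close> with a symmetric operator \<open>T\<close> on the horizontal plane, the hypothesis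
  says that \<open>T\<close> has trace zero. The conclusion is the sum of two instances of
  \<open>horizontal_plane_identity\<close>.
\<close>

lemma tracefree_identity:
  assumes [simp]: "horizontal X" "horizontal Y" "horizontal Z" "horizontal X'" "horizontal Y'"
    and "ip (phi_field Y) X' = ip (phi_field X) Y'"
  shows "ip Y Z \<odot> X' - ip X Z \<odot> Y' + ip Y' Z \<odot> X - ip X' Z \<odot> Y = 0"
  using horizontal_plane_identity[of Y X' Z] horizontal_plane_identity[of X Y' Z] assms(6)
  by (simp add: algebra_simps)

lemma R4_hor:
  assumes [simp]: "horizontal X" "horizontal Y" "horizontal Z"
  shows "R4 \<phi> \<xi> g X Y Z = 0"
  unfolding R4_def
proof (rule tracefree_identity)
  show "ip (phi_field Y) (h_op \<phi> \<xi> X) = ip (phi_field X) (h_op \<phi> \<xi> Y)"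
    using ip_commute[of "shape0 Y" X] by (simp add: h_op_hor ip_phi_phi shape0_symmetric[symmetric])
qed (simp_all add: h_op_hor)

lemma shape0_phi_cross: "horizontal X \<Longrightarrow> horizontal Y \<Longrightarrow> ip (phi_field Y) (shape0 X) = ip (phi_field X) (shape0 Y)"
  using ip_phi_swap[of "shape0 Y" X] ip_commute[of "shape0 Y" "phi_field X"]
  by (simp add: shape0_symmetric[symmetric] shape0_phi ip_simps ip_phi_left)

lemma R7_hor:
  assumes [simp]: "horizontal X" "horizontal Y" "horizontal Z"
  shows "R7 \<phi> \<xi> g X Y Z = 0"
  unfolding R7_def
  by (rule tracefree_identity) (simp_all add: phi_h_op_hor ip_simps shape0_phi_cross[of X Y])

text \<open>
  Expand the Gauss equation with \<open>B = \<alpha> + S\<close>. The terms linear in \<open>S\<close> cancel by \<open>tracefree_identity\<close>, and the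
  quadratic ones give \<open>det S = - \<lambda>\<^sup>2\<close> times \<open>R\<^sub>1\<close>, up to sign.
\<close>

lemma curvature_hor:
  assumes [simp]: "horizontal X" "horizontal Y" "horizontal Z"
  shows "curvature nabla X Y Z = (\<kappa> + 2 * (alpha * alpha)) \<odot> (ip X Z \<odot> Y - ip Y Z \<odot> X)"
proof -
  have "ip (phi_field (shape0 X)) (shape0 Y) = ip (- shape0 (phi_field X)) (shape0 Y)"
    by (simp add: shape0_phi)
  also have "\<dots> = - ip (phi_field X) (shape0 (shape0 Y))"
    by (simp add: ip_minus_left shape0_symmetric)
  also have "\<dots> = (\<kappa> + alpha * alpha) * ip (phi_field X) Y"
    by (simp add: shape0_squared ip_simps algebra_simps)
  finally have det: "ip (shape0 X) Z \<odot> shape0 Y - ip (shape0 Y) Z \<odot> shape0 X =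
      (\<kappa> + alpha * alpha) \<odot> (ip X Z \<odot> Y - ip Y Z \<odot> X)"
    using horizontal_plane_identity[of "shape0 X" "shape0 Y" Z] horizontal_plane_identity[of X Y Z]
    by (simp add: fscale_simps)
  have tf: "ip Y Z \<odot> shape0 X - ip X Z \<odot> shape0 Y + ip (shape0 Y) Z \<odot> X - ip (shape0 X) Z \<odot> Y = 0"
    by (rule tracefree_identity) (simp_all add: shape0_phi_cross[of X Y])
  have "curvature nabla X Y Z p f =
      ((\<kappa> + 2 * (alpha * alpha)) \<odot> (ip X Z \<odot> Y - ip Y Z \<odot> X)) p f" for p f
  proof -
    have c: "curvature nabla X Y Z = (ip (shape0 X) Z + alpha * ip X Z) \<odot> (shape0 Y + alpha \<odot> Y)
        - (ip (shape0 Y) Z + alpha * ip Y Z) \<odot> (shape0 X + alpha \<odot> X)"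
      by (simp add: gauss_equation shape_eq ip_simps)
    have "\<alpha> * (ip Y Z \<odot> shape0 X - ip X Z \<odot> shape0 Y + ip (shape0 Y) Z \<odot> X - ip (shape0 X) Z \<odot> Y) p f = 0"
      by (simp only: tf zero_fun_apply mult_zero_right)
    then show ?thesis
      unfolding c using fun_cong[OF fun_cong[OF det, of p], of f]
      by (simp add: fscale_def algebra_simps)
  qed
  then show ?thesis by blast
qed

lemma h_op_symmetric: "horizontal X \<Longrightarrow> horizontal Y \<Longrightarrow> ip (h_op \<phi> \<xi> X) Y = ip (h_op \<phi> \<xi> Y) X"
  and phi_h_op_symmetric: "horizontal X \<Longrightarrow> horizontal Y \<Longrightarrow> ip (phi_h_op \<phi> \<xi> X) Y = ip (phi_h_op \<phi> \<xi> Y) X"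
  using ip_commute[of "shape0 X" "phi_field Y"] ip_commute[of "shape0 Y" X] shape0_phi_cross[of X Y]
    ip_commute[of "shape0 X" Y] shape0_symmetric[of X Y]
  by (simp_all add: h_op_hor phi_h_op_hor ip_simps ip_phi_left ip_commute[of "shape0 Y" "phi_field X"])

text \<open>
  Pair symmetry turns \<open>g(R(\<xi>,Y)Z, W)\<close> into \<open>g(R(Z,W)\<xi>, Y)\<close>, which the defining condition prescribes.
\<close>

lemma curvature_xi_hor:
  assumes [simp]: "horizontal Y" "horizontal Z"
  shows "curvature nabla \<xi> Y Z =
    (\<kappa> * ip Y Z + \<mu> * ip (h_op \<phi> \<xi> Y) Z + \<nu> * ip (phi_h_op \<phi> \<xi> Y) Z) \<odot> \<xi>" (is "_ = ?w \<odot> \<xi>")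
proof (rule vector_field_eq_by_ip)
  have [simp]: "horizontal (h_op \<phi> \<xi> V)" "horizontal (phi_h_op \<phi> \<xi> V)" if "horizontal V" for V
    using that by (simp_all add: h_op_hor phi_h_op_hor)
  have [simp]: "vector_field A (h_op \<phi> \<xi> V)" "vector_field A (phi_h_op \<phi> \<xi> V)"
    if "vector_field A V" for V
    using that by (simp_all add: h_op_eq phi_h_op_eq)
  show "vector_field A (?w \<odot> \<xi>)" "vector_field A (curvature nabla \<xi> Y Z)"
    by (simp_all add: vector_field_curvature)
  fix W assume W [simp]: "vector_field A W"
  have "ip (curvature nabla \<xi> Y Z) W = ip (curvature nabla Z W \<xi>) Y"
    by (rule curvature_pair_symmetry) simp_all
  also have "\<dots> = eta_field W * (\<kappa> * ip Z Y + \<mu> * ip (h_op \<phi> \<xi> Z) Y + \<nu> * ip (phi_h_op \<phi> \<xi> Z) Y)"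
    by (simp add: curvature_xi hor_eta fscale_simps ip_simps algebra_simps)
  also have "\<dots> = ip (?w \<odot> \<xi>) W"
    using h_op_symmetric[of Z Y] phi_h_op_symmetric[of Z Y] ip_commute[of Z Y] ip_commute[of \<xi> W]
    by (simp add: ip_simps eta_field_eq algebra_simps)
  finally show "ip (curvature nabla \<xi> Y Z) W = ip (?w \<odot> \<xi>) W" .
qed

lemma horizontal_decomposition:
  assumes "vector_field A X"
  obtains X' where "horizontal X'" "X = X' + eta_field X \<odot> \<xi>"
  using hor_projection[OF assms] by (metis diff_add_cancel)

lemma h_op_add_xi:
  assumes [simp]: "horizontal X" "smooth_fun A a"
  shows "h_op \<phi> \<xi> (X + a \<odot> \<xi>) = h_op \<phi> \<xi> X" "phi_h_op \<phi> \<xi> (X + a \<odot> \<xi>) = phi_h_op \<phi> \<xi> X"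
proof -
  show h: "h_op \<phi> \<xi> (X + a \<odot> \<xi>) = h_op \<phi> \<xi> X"
    by (simp add: h_op_eq nabla_simps shape_xi phi_simps fscale_simps)
  show "phi_h_op \<phi> \<xi> (X + a \<odot> \<xi>) = phi_h_op \<phi> \<xi> X"
    by (simp add: phi_h_op_def h)
qed

lemma hor_h_op [simp]: "horizontal X \<Longrightarrow> horizontal (h_op \<phi> \<xi> X)" "horizontal X \<Longrightarrow> horizontal (phi_h_op \<phi> \<xi> X)"
  by (simp_all add: h_op_hor phi_h_op_hor)

text \<open>
  The component \<open>R(\<xi>,\<xi>)Z\<close> vanishes by antisymmetry. The last term is left unexpanded, since \<open>R(X,Y)\<xi>\<close> is
  known for arbitrary fields.
\<close>

lemma curvature_add_xi:
  assumes [simp]: "horizontal X" "horizontal Y" "horizontal Z" "smooth_fun A x" "smooth_fun A y" "smooth_fun A z"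
  shows "curvature nabla (X + x \<odot> \<xi>) (Y + y \<odot> \<xi>) (Z + z \<odot> \<xi>) =
    curvature nabla X Y Z - y \<odot> curvature nabla \<xi> X Z + x \<odot> curvature nabla \<xi> Y Z
    + z \<odot> curvature nabla (X + x \<odot> \<xi>) (Y + y \<odot> \<xi>) \<xi>"
proof -
  have 1: "curvature nabla X \<xi> Z = - curvature nabla \<xi> X Z"
    by (rule curvature_antisym) simp_all
  have 2: "curvature nabla \<xi> \<xi> Z = 0"
    by (rule vfield_eq_minus_self) (rule curvature_antisym, simp_all)
  have "curvature nabla (X + x \<odot> \<xi>) (Y + y \<odot> \<xi>) (Z + z \<odot> \<xi>) =
      curvature nabla (X + x \<odot> \<xi>) (Y + y \<odot> \<xi>) Z
      + z \<odot> curvature nabla (X + x \<odot> \<xi>) (Y + y \<odot> \<xi>) \<xi>"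
    by (simp add: curvature_add_right curvature_fscale_right)
  moreover have "curvature nabla (X + x \<odot> \<xi>) (Y + y \<odot> \<xi>) Z =
      curvature nabla X Y Z - y \<odot> curvature nabla \<xi> X Z + x \<odot> curvature nabla \<xi> Y Z"
    by (simp add: curvature_add_left curvature_fscale_left curvature_add_mid curvature_fscale_mid
        1 2 fscale_simps)
  ultimately show ?thesis by simp
qed

lemma ip_add_xi:
  "horizontal X \<Longrightarrow> horizontal Y \<Longrightarrow> smooth_fun A x \<Longrightarrow> smooth_fun A y \<Longrightarrow>
    ip (X + x \<odot> \<xi>) (Y + y \<odot> \<xi>) = ip X Y + x * y"
  "horizontal X \<Longrightarrow> horizontal Y \<Longrightarrow> smooth_fun A y \<Longrightarrow> ip X (Y + y \<odot> \<xi>) = ip X Y"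
  by (simp_all add: ip_simps hor_ip_xi ip_xi_xi)

lemma eta_add_xi: "horizontal X \<Longrightarrow> smooth_fun A x \<Longrightarrow> eta_field (X + x \<odot> \<xi>) = x"
  by (simp add: eta_field_eq ip_simps hor_ip_xi ip_xi_xi)

lemma R4_add_xi:
  assumes [simp]: "horizontal X" "horizontal Y" "horizontal Z" "smooth_fun A x" "smooth_fun A y" "smooth_fun A z"
  shows "R4 \<phi> \<xi> g (X + x \<odot> \<xi>) (Y + y \<odot> \<xi>) (Z + z \<odot> \<xi>) =
    z \<odot> (y \<odot> h_op \<phi> \<xi> X - x \<odot> h_op \<phi> \<xi> Y)
    + (x * ip (h_op \<phi> \<xi> Y) Z - y * ip (h_op \<phi> \<xi> X) Z) \<odot> \<xi>" (is "_ = ?r")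
proof -
  have "R4 \<phi> \<xi> g (X + x \<odot> \<xi>) (Y + y \<odot> \<xi>) (Z + z \<odot> \<xi>) = R4 \<phi> \<xi> g X Y Z + ?r"
    by (simp add: R4_def h_op_add_xi ip_add_xi) (simp add: fun_eq_iff fscale_def algebra_simps)
  then show ?thesis by (simp add: R4_hor)
qed

lemma R7_add_xi:
  assumes [simp]: "horizontal X" "horizontal Y" "horizontal Z" "smooth_fun A x" "smooth_fun A y" "smooth_fun A z"
  shows "R7 \<phi> \<xi> g (X + x \<odot> \<xi>) (Y + y \<odot> \<xi>) (Z + z \<odot> \<xi>) =
    z \<odot> (y \<odot> phi_h_op \<phi> \<xi> X - x \<odot> phi_h_op \<phi> \<xi> Y)
    + (x * ip (phi_h_op \<phi> \<xi> Y) Z - y * ip (phi_h_op \<phi> \<xi> X) Z) \<odot> \<xi>" (is "_ = ?r")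
proof -
  have "R7 \<phi> \<xi> g (X + x \<odot> \<xi>) (Y + y \<odot> \<xi>) (Z + z \<odot> \<xi>) = R7 \<phi> \<xi> g X Y Z + ?r"
    by (simp add: R7_def h_op_add_xi ip_add_xi) (simp add: fun_eq_iff fscale_def algebra_simps)
  then show ?thesis by (simp add: R7_hor)
qed

text \<open>
  Split all three arguments into a horizontal field and a multiple of \<open>\<xi>\<close>. The components of the
  left-hand side are known from \<open>curvature_hor\<close>, \<open>curvature_xi_hor\<close> and the defining condition, and the
  identity is then one between explicit linear combinations.
\<close>

theorem curvature_formula:
  assumes X: "vector_field A X" and Y: "vector_field A Y" and Z: "vector_field A Z"
  shows "curvature nabla X Y Z =
    (- (\<kappa> + 2 * (alpha * alpha))) \<odot> R1 g X Y Z - (2 * (\<kappa> + alpha * alpha)) \<odot> R3 \<xi> \<eta> g X Y Z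
    + \<mu> \<odot> R4 \<phi> \<xi> g X Y Z + \<nu> \<odot> R7 \<phi> \<xi> g X Y Z"
proof -
  have main: "curvature nabla (X + x \<odot> \<xi>) (Y + y \<odot> \<xi>) (Z + z \<odot> \<xi>) =
      (- (\<kappa> + 2 * (alpha * alpha))) \<odot> R1 g (X + x \<odot> \<xi>) (Y + y \<odot> \<xi>) (Z + z \<odot> \<xi>)
      - (2 * (\<kappa> + alpha * alpha)) \<odot> R3 \<xi> \<eta> g (X + x \<odot> \<xi>) (Y + y \<odot> \<xi>) (Z + z \<odot> \<xi>)
      + \<mu> \<odot> R4 \<phi> \<xi> g (X + x \<odot> \<xi>) (Y + y \<odot> \<xi>) (Z + z \<odot> \<xi>)
      + \<nu> \<odot> R7 \<phi> \<xi> g (X + x \<odot> \<xi>) (Y + y \<odot> \<xi>) (Z + z \<odot> \<xi>)"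
    if [simp]: "horizontal X" "horizontal Y" "horizontal Z" "smooth_fun A x" "smooth_fun A y" "smooth_fun A z" for X Y Z x y z
  proof -
    have 1: "curvature nabla (X + x \<odot> \<xi>) (Y + y \<odot> \<xi>) \<xi> =
        \<kappa> \<odot> (y \<odot> (X + x \<odot> \<xi>) - x \<odot> (Y + y \<odot> \<xi>))
        + \<mu> \<odot> (y \<odot> h_op \<phi> \<xi> X - x \<odot> h_op \<phi> \<xi> Y)
        + \<nu> \<odot> (y \<odot> phi_h_op \<phi> \<xi> X - x \<odot> phi_h_op \<phi> \<xi> Y)"
      by (simp add: curvature_xi eta_add_xi h_op_add_xi)
    have 2: "R1 g (X + x \<odot> \<xi>) (Y + y \<odot> \<xi>) (Z + z \<odot> \<xi>) =
        (ip Y Z + y * z) \<odot> (X + x \<odot> \<xi>) - (ip X Z + x * z) \<odot> (Y + y \<odot> \<xi>)"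
      by (simp add: R1_def ip_add_xi)
    have 3: "R3 \<xi> \<eta> g (X + x \<odot> \<xi>) (Y + y \<odot> \<xi>) (Z + z \<odot> \<xi>) =
        (x * z) \<odot> (Y + y \<odot> \<xi>) - (y * z) \<odot> (X + x \<odot> \<xi>)
        + ((ip X Z + x * z) * y) \<odot> \<xi> - ((ip Y Z + y * z) * x) \<odot> \<xi>"
      by (simp add: R3_def eta_add_xi ip_add_xi)
    show ?thesis
      unfolding curvature_add_xi[OF that] 1 2 3 R4_add_xi[OF that] R7_add_xi[OF that]
        curvature_hor[OF that(1-3)] curvature_xi_hor[OF that(1,3)] curvature_xi_hor[OF that(2,3)]
      by (simp add: fun_eq_iff fscale_def algebra_simps)
  qed
  obtain X' Y' Z' where X': "horizontal X'" "X = X' + eta_field X \<odot> \<xi>" and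
    Y': "horizontal Y'" "Y = Y' + eta_field Y \<odot> \<xi>" and Z': "horizontal Z'" "Z = Z' + eta_field Z \<odot> \<xi>"
    using horizontal_decomposition X Y Z by metis
  show ?thesis
    using main[OF X'(1) Y'(1) Z'(1) smooth_eta[OF X] smooth_eta[OF Y] smooth_eta[OF Z]]
    by (simp only: X'(2)[symmetric] Y'(2)[symmetric] Z'(2)[symmetric])
qed

end

lemma leafwise_constant_kappa_spaceI:
  fixes A :: "('m::{t2_space, second_countable_topology}, real ^ 3) chart set"
  assumes "kappa_mu_nu_space A \<phi> \<xi> \<eta> g nabla \<kappa> \<mu> \<nu>"
    and d_eta: "\<And>X Y. vector_field A X \<Longrightarrow> vector_field A Y \<Longrightarrow> ext_deriv1 \<eta> X Y = 0"
    and d_Phi: "\<And>X Y Z. vector_field A X \<Longrightarrow> vector_field A Y \<Longrightarrow> vector_field A Z \<Longrightarrow>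
      ext_deriv2 (fundamental_form \<phi> g) X Y Z =
        (\<lambda>_. 2 * \<alpha>) * wedge12 \<eta> (fundamental_form \<phi> g) X Y Z"
    and less: "\<And>p. \<kappa> p < - \<alpha>\<^sup>2" and \<kappa>: "varies_only_along A g \<xi> \<kappa>"
  shows "leafwise_constant_kappa_space A \<phi> \<xi> \<eta> g nabla \<alpha> \<kappa> \<mu> \<nu>"
proof -
  interpret kappa_mu_nu_space A \<phi> \<xi> \<eta> g nabla \<kappa> \<mu> \<nu> by (rule assms(1))
  show ?thesis
  proof
    show "levi_civita A g nabla" by (rule connection)
    show "dir_deriv X \<kappa> = 0" if "horizontal X" for X
      using \<kappa> that by (simp add: varies_only_along_def hor_iff)
  qed (use d_eta d_Phi less in auto)
qed

theorem corollary3p32: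
  fixes A :: "('m::{t2_space, second_countable_topology}, real ^ 3) chart set"
    and \<phi> :: "'m \<Rightarrow> 'm tvec \<Rightarrow> 'm tvec"
    and \<xi> :: "'m vfield"
    and \<eta> :: "'m \<Rightarrow> 'm tvec \<Rightarrow> real"
    and g :: "'m \<Rightarrow> 'm tvec \<Rightarrow> 'm tvec \<Rightarrow> real"
    and nabla :: "'m vfield \<Rightarrow> 'm vfield \<Rightarrow> 'm vfield"
    and \<kappa> \<mu> \<nu> :: "'m \<Rightarrow> real"
  assumes "kappa_mu_nu_space A \<phi> \<xi> \<eta> g nabla \<kappa> \<mu> \<nu>"
  shows "(almost_cosymplectic_manifold A \<phi> \<xi> \<eta> g \<and>
          (\<forall>p. \<kappa> p < 0) \<and>
          varies_only_along A g \<xi> \<kappa> \<and>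
          varies_only_along A g \<xi> \<mu> \<and>
          varies_only_along A g \<xi> \<nu> \<longrightarrow>
            (\<forall>X Y Z. vector_field A X \<and> vector_field A Y \<and> vector_field A Z \<longrightarrow>
              curvature nabla X Y Z =
                (- \<kappa>) \<odot> R1 g X Y Z - (2 * \<kappa>) \<odot> R3 \<xi> \<eta> g X Y Z
                + \<mu> \<odot> R4 \<phi> \<xi> g X Y Z + \<nu> \<odot> R7 \<phi> \<xi> g X Y Z))
       \<and> (almost_kenmotsu_manifold A \<phi> \<xi> \<eta> g \<and>
          (\<forall>p. \<kappa> p < - 1) \<and>
          varies_only_along A g \<xi> \<kappa> \<longrightarrow>
            (\<forall>X Y Z. vector_field A X \<and> vector_field A Y \<and> vector_field A Z \<longrightarrow>
              curvature nabla X Y Z =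
                (- (\<kappa> + 2)) \<odot> R1 g X Y Z - (2 * (\<kappa> + 1)) \<odot> R3 \<xi> \<eta> g X Y Z
                + \<mu> \<odot> R4 \<phi> \<xi> g X Y Z + \<nu> \<odot> R7 \<phi> \<xi> g X Y Z))"
proof (intro conjI impI allI; elim conjE)
  fix X Y Z
  assume "almost_cosymplectic_manifold A \<phi> \<xi> \<eta> g" and less: "\<forall>p. \<kappa> p < 0"
    and \<kappa>: "varies_only_along A g \<xi> \<kappa>"
    and XYZ: "vector_field A X" "vector_field A Y" "vector_field A Z"
  then interpret almost_cosymplectic_manifold A \<phi> \<xi> \<eta> g by simp
  interpret leafwise_constant_kappa_space A \<phi> \<xi> \<eta> g nabla 0 \<kappa> \<mu> \<nu>
    by (rule leafwise_constant_kappa_spaceI)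
      (use assms \<kappa> less d_eta d_Phi in \<open>simp_all add: zero_fun_def[symmetric]\<close>)
  show "curvature nabla X Y Z =
      (- \<kappa>) \<odot> R1 g X Y Z - (2 * \<kappa>) \<odot> R3 \<xi> \<eta> g X Y Z
      + \<mu> \<odot> R4 \<phi> \<xi> g X Y Z + \<nu> \<odot> R7 \<phi> \<xi> g X Y Z"
    using curvature_formula[OF XYZ] by (simp add: zero_fun_def[symmetric])
next
  fix X Y Z
  assume "almost_kenmotsu_manifold A \<phi> \<xi> \<eta> g" and less: "\<forall>p. \<kappa> p < - 1"
    and \<kappa>: "varies_only_along A g \<xi> \<kappa>"
    and XYZ: "vector_field A X" "vector_field A Y" "vector_field A Z"
  then interpret almost_kenmotsu_manifold A \<phi> \<xi> \<eta> g by simp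
  have 2: "(\<lambda>_. 2 * 1) = (2 :: 'm \<Rightarrow> real)" by (simp add: numeral_fun)
  interpret leafwise_constant_kappa_space A \<phi> \<xi> \<eta> g nabla 1 \<kappa> \<mu> \<nu>
    by (rule leafwise_constant_kappa_spaceI) (use assms \<kappa> less d_eta d_Phi 2 in simp_all)
  show "curvature nabla X Y Z =
      (- (\<kappa> + 2)) \<odot> R1 g X Y Z - (2 * (\<kappa> + 1)) \<odot> R3 \<xi> \<eta> g X Y Z
      + \<mu> \<odot> R4 \<phi> \<xi> g X Y Z + \<nu> \<odot> R7 \<phi> \<xi> g X Y Z"
    using curvature_formula[OF XYZ] by (simp add: one_fun_def[symmetric])
qed

end
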